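(* Let $n\ge 2$, let $C\in\mathbb{R}_+^{n\times n}$ be a nonnegative cost matrix, let $r,c\in\mathbb{R}^n$ be vectors with positive entries each summing to one, and let $\varepsilon>0$. Let $\hat P$ be the output of $\textsc{ApproxOT}(C,r,c,\varepsilon)$ (described in the context). Then $\hat P\in\mathcal{U}_{r,c}$ and $$\langle \hat P, C\rangle \le \min_{P\in\mathcal{U}_{r,c}}\langle P,C\rangle+\varepsilon,$$ and $\textsc{ApproxOT}$ runs in time $O(n^2+S)$, where $S$ is the running time of the subroutine $\textsc{Proj}(A,\mathcal{U}_{r,c},\varepsilon')$. In particular, if $\|C\|_\infty\le L$, then $S$ can be taken to be $O(n^2L^3(\log n)\varepsilon^{-3})$ (by using either the $\textsc{Sinkhorn}$ or the $\textsc{Greenkhorn}$ algorithm as $\textsc{Proj}$), so that $\textsc{ApproxOT}$ runs in $O(n^2L^3(\log n)\varepsilon^{-3})$ time.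
   Context: Notation: $\mathbf{1}\in\mathbb{R}^n$ is the all-ones vector; for $A\in\mathbb{R}^{n\times n}$, $r(A)=A\mathbf{1}$ and $c(A)=A^\top\mathbf{1}$ are its row and column sum vectors, with coordinates $r_i(A)$, $c_j(A)$; $\|A\|_\infty=\max_{ij}|A_{ij}|$, $\|A\|_1=\sum_{ij}|A_{ij}|$; $\langle A,B\rangle=\sum_{ij}A_{ij}B_{ij}$; $\mathbf{D}(x)$ is the diagonal matrix with diagonal $x$; $\exp(M)$ denotes the entrywise exponential; $a\wedge b=\min(a,b)$. The transport polytope is $\mathcal{U}_{r,c}=\{P\in\mathbb{R}_+^{n\times n}: P\mathbf{1}=r,\ P^\top\mathbf{1}=c\}$. Running time counts elementary arithmetic operations (including exponentials) at unit cost. $\textsc{Proj}(A,\mathcal{U}_{r,c},\varepsilon')$ denotes any subroutine which, given an entrywise positive matrix $A$, outputs a matrix $B=XAY$ with $X,Y$ diagonal matrices with positive diagonal entries such that $\|r(B)-r\|_1+\|c(B)-c\|_1\le\varepsilon'$. Two such subroutines are: - $\textsc{Sinkhorn}$: set $A^{(0)}=A/\|A\|_1$, $x^0=y^0=\mathbf{0}$, $k=0$; while $\|r(A^{(k)})-r\|_1+\|c(A^{(k)})-c\|_1>\varepsilon'$: increment $k$; if $k$ is odd set $x^k_i=x^{k-1}_i+\log\frac{r_i}{r_i(A^{(k-1)})}$ for all $i$ and $y^k=y^{k-1}$; if $k$ is even set $y^k_j=y^{k-1}_j+\log\frac{c_j}{c_j(A^{(k-1)})}$ for all $j$ and $x^k=x^{k-1}$;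 then set $A^{(k)}=\mathbf{D}(\exp(x^k))A^{(0)}\mathbf{D}(\exp(y^k))$. Output the final $A^{(k)}$. - $\textsc{Greenkhorn}$: with $\rho(a,b)=b-a+a\log\frac ab$, set $A^{(0)}=A/\|A\|_1$, $x=y=\mathbf{0}$, current matrix $A'=A^{(0)}$; while $\|r(A')-r\|_1+\|c(A')-c\|_1>\varepsilon'$: let $I\in\arg\max_i\rho(r_i,r_i(A'))$, $J\in\arg\max_j\rho(c_j,c_j(A'))$; if $\rho(r_I,r_I(A'))>\rho(c_J,c_J(A'))$ set $x_I\leftarrow x_I+\log\frac{r_I}{r_I(A')}$, else set $y_J\leftarrow y_J+\log\frac{c_J}{c_J(A')}$; then set $A'=\mathbf{D}(\exp(x))A^{(0)}\mathbf{D}(\exp(y))$. Output the final $A'$. $\textsc{round}(F,\mathcal{U}_{r,c})$, for $F\in\mathbb{R}_+^{n\times n}$: let $x_i=\frac{r_i}{r_i(F)}\wedge 1$, $F'=\mathbf{D}(x)F$; let $y_j=\frac{c_j}{c_j(F')}\wedge 1$, $F''=F'\mathbf{D}(y)$; let $\mathrm{err}_r=r-r(F'')$, $\mathrm{err}_c=c-c(F'')$; output $G=F''+\mathrm{err}_r\mathrm{err}_c^\top/\|\mathrm{err}_r\|_1$. $\textsc{ApproxOT}(C,r,c,\varepsilon)$: set $\eta=\frac{4\log n}{\varepsilon}$ and $\varepsilon'=\frac{\varepsilon}{8\|C\|_\infty}$; compute $A=\exp(-\eta C)$; compute $B=\textsc{Proj}(A,\mathcal{U}_{r,c},\varepsilon')$;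 output $\hat P=\textsc{round}(B,\mathcal{U}_{r,c})$.
   Formalization: The O(n²L³(log n)ε⁻³) bounds are proved for ε ≤ κL, for each fixed κ > 0, with a constant depending on κ (without this the bound tends to 0 as ε/L → ∞, though n² operations are always needed); for C = 0 the undefined ε' is read as infinity. *)

theory Defs
  imports
    Complex_Main
    "HOL-Library.Extended_Real"
    "HOL-Library.Monad_Syntax"
    "HOL-Library.While_Combinator"
    "Jordan_Normal_Form.Matrix"
begin

section \<open>Matrices and the transport polytope\<close>

definition row_sums :: "real mat \<Rightarrow> real vec" where
  "row_sums A = A *\<^sub>v vec (dim_col A) (\<lambda>_. 1)"

definition col_sums :: "real mat \<Rightarrow> real vec" where
  "col_sums A = transpose_mat A *\<^sub>v vec (dim_row A) (\<lambda>_. 1)"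

definition l1_norm :: "real vec \<Rightarrow> real" where
  "l1_norm v = (\<Sum>i<dim_vec v. \<bar>v $ i\<bar>)"

definition max_norm :: "real mat \<Rightarrow> real" where
  "max_norm A = Max (abs ` elements_mat A)"

definition entry_l1_norm :: "real mat \<Rightarrow> real" where
  "entry_l1_norm A = (\<Sum>i<dim_row A. \<Sum>j<dim_col A. \<bar>A $$ (i, j)\<bar>)"

definition frob :: "real mat \<Rightarrow> real mat \<Rightarrow> real" where
  "frob A B = (\<Sum>i<dim_row A. \<Sum>j<dim_col A. A $$ (i, j) * B $$ (i, j))"

definition nonneg_mat :: "nat \<Rightarrow> real mat \<Rightarrow> bool" where
  "nonneg_mat n A \<longleftrightarrow> A \<in> carrier_mat n n \<and> (\<forall>i<n. \<forall>j<n. 0 \<le> A $$ (i, j))"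

definition pos_mat :: "nat \<Rightarrow> real mat \<Rightarrow> bool" where
  "pos_mat n A \<longleftrightarrow> A \<in> carrier_mat n n \<and> (\<forall>i<n. \<forall>j<n. 0 < A $$ (i, j))"

definition pos_prob_vec :: "nat \<Rightarrow> real vec \<Rightarrow> bool" where
  "pos_prob_vec n r \<longleftrightarrow> r \<in> carrier_vec n \<and> (\<forall>i<n. 0 < r $ i) \<and> (\<Sum>i<n. r $ i) = 1"

definition transport_polytope :: "nat \<Rightarrow> real vec \<Rightarrow> real vec \<Rightarrow> real mat set" where
  "transport_polytope n r c = {P. nonneg_mat n P \<and> row_sums P = r \<and> col_sums P = c}"

definition marginal_error :: "real mat \<Rightarrow> real vec \<Rightarrow> real vec \<Rightarrow> real" where
  "marginal_error A r c = l1_norm (row_sums A - r) + l1_norm (col_sums A - c)"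

definition diag_scale :: "(nat \<Rightarrow> real) \<Rightarrow> real mat \<Rightarrow> (nat \<Rightarrow> real) \<Rightarrow> real mat" where
  "diag_scale x A y = mat_diag (dim_row A) x * A * mat_diag (dim_col A) y"

definition rho :: "real \<Rightarrow> real \<Rightarrow> real" where
  "rho a b = b - a + a * ln (a / b)"


section \<open>Counting arithmetic operations\<close>

text \<open>
  A computation is a pair of its result and the number of elementary operations performed.
  \<open>op\<close> is always applied to a single arithmetic operation, comparison, exponential or
  logarithm whose arguments are already available. Sums, maxima and argmax of \<open>n\<close> values
  cost \<open>n\<close> further operations.
  Reading, writing and copying of stored values is free, as only arithmetic is counted.
\<close>

type_synonym 'a tm = "'a \<times> nat"

definition op :: "'a \<Rightarrow> 'a tm" where
  "op x = (x, 1)"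

definition ret :: "'a \<Rightarrow> 'a tm" where
  "ret x = (x, 0)"

definition bind_tm :: "'a tm \<Rightarrow> ('a \<Rightarrow> 'b tm) \<Rightarrow> 'b tm" where
  "bind_tm m f = (fst (f (fst m)), snd m + snd (f (fst m)))"

adhoc_overloading Monad_Syntax.bind \<rightleftharpoons> bind_tm

definition sum_tm :: "nat \<Rightarrow> (nat \<Rightarrow> real tm) \<Rightarrow> real tm" where
  "sum_tm n f = ((\<Sum>i<n. fst (f i)), (\<Sum>i<n. snd (f i)) + n)"

definition max_tm :: "nat \<Rightarrow> (nat \<Rightarrow> real tm) \<Rightarrow> real tm" where
  "max_tm n f = (Max ((\<lambda>i. fst (f i)) ` {..<n}), (\<Sum>i<n. snd (f i)) + n)"

definition vec_tm :: "nat \<Rightarrow> (nat \<Rightarrow> real tm) \<Rightarrow> real vec tm" where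
  "vec_tm n f = (vec n (\<lambda>i. fst (f i)), (\<Sum>i<n. snd (f i)))"

definition mat_tm :: "nat \<Rightarrow> nat \<Rightarrow> (nat \<Rightarrow> nat \<Rightarrow> real tm) \<Rightarrow> real mat tm" where
  "mat_tm m n f = (mat m n (\<lambda>(i, j). fst (f i j)), (\<Sum>i<m. \<Sum>j<n. snd (f i j)))"

text \<open>\<open>None\<close> is nontermination. Every evaluation of the guard is paid for, including the
  last one.\<close>

definition while_tm :: "('s \<Rightarrow> bool tm) \<Rightarrow> ('s \<Rightarrow> 's tm) \<Rightarrow> 's \<Rightarrow> 's tm option" where
  "while_tm b f s0 =
     map_option (\<lambda>(s, t). (s, t + snd (b s)))
       (while_option (\<lambda>(s, t). fst (b s))
                     (\<lambda>(s, t). (fst (f s), t + snd (b s) + snd (f s))) (s0, 0))"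

definition row_sums_tm :: "real mat \<Rightarrow> real vec tm" where
  "row_sums_tm A = vec_tm (dim_row A) (\<lambda>i. sum_tm (dim_col A) (\<lambda>j. ret (A $$ (i, j))))"

definition col_sums_tm :: "real mat \<Rightarrow> real vec tm" where
  "col_sums_tm A = vec_tm (dim_col A) (\<lambda>j. sum_tm (dim_row A) (\<lambda>i. ret (A $$ (i, j))))"

definition l1_norm_tm :: "real vec \<Rightarrow> real tm" where
  "l1_norm_tm v = sum_tm (dim_vec v) (\<lambda>i. op \<bar>v $ i\<bar>)"

definition sub_vec_tm :: "real vec \<Rightarrow> real vec \<Rightarrow> real vec tm" where
  "sub_vec_tm u v = vec_tm (dim_vec v) (\<lambda>i. op (u $ i - v $ i))"

definition normalize_tm :: "real mat \<Rightarrow> real mat tm" where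
  "normalize_tm A = do {
     N \<leftarrow> sum_tm (dim_row A) (\<lambda>i. sum_tm (dim_col A) (\<lambda>j. op \<bar>A $$ (i, j)\<bar>));
     mat_tm (dim_row A) (dim_col A) (\<lambda>i j. op (A $$ (i, j) / N))
   }"

text \<open>An entry of $\mathbf{D}(\exp x)\,A\,\mathbf{D}(\exp y)$.\<close>

definition scaled_entry_tm :: "real \<Rightarrow> real \<Rightarrow> real \<Rightarrow> real tm" where
  "scaled_entry_tm u a v = do {
     p \<leftarrow> op (exp u); q \<leftarrow> op (exp v); z \<leftarrow> op (p * a); op (z * q)
   }"

definition update_tm :: "real \<Rightarrow> real \<Rightarrow> real \<Rightarrow> real tm" where
  "update_tm u a b = do { q \<leftarrow> op (a / b); l \<leftarrow> op (ln q); op (u + l) }"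

definition rho_tm :: "real \<Rightarrow> real \<Rightarrow> real tm" where
  "rho_tm a b = do {
     d \<leftarrow> op (b - a); q \<leftarrow> op (a / b); l \<leftarrow> op (ln q); m \<leftarrow> op (a * l); op (d + m)
   }"

text \<open>The stopping test of the scaling algorithms, given the row sums \<open>s\<close> and the column
  sums \<open>t\<close> of the current matrix.\<close>

definition inaccurate_tm ::
  "real vec \<Rightarrow> real vec \<Rightarrow> ereal \<Rightarrow> real vec \<Rightarrow> real vec \<Rightarrow> bool tm" where
  "inaccurate_tm r c \<delta> s t = do {
     u \<leftarrow> sub_vec_tm s r; dr \<leftarrow> l1_norm_tm u;
     v \<leftarrow> sub_vec_tm t c; dc \<leftarrow> l1_norm_tm v;
     e \<leftarrow> op (dr + dc);
     op (\<delta> < ereal e)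
   }"


section \<open>Projection subroutines\<close>

text \<open>
  The accuracy of a projection is an extended real, so that $\varepsilon / (8\|C\|_\infty)$
  is meaningful for $C = 0$ as well: it is then \<open>\<infinity>\<close>, i.e. nothing is required of the
  marginals.
\<close>

type_synonym subroutine = "real mat \<Rightarrow> real vec \<Rightarrow> real vec \<Rightarrow> ereal \<Rightarrow> real mat tm option"

definition proj_subroutine :: "nat \<Rightarrow> subroutine \<Rightarrow> bool" where
  "proj_subroutine n proj \<longleftrightarrow>
     (\<forall>A r c \<delta>. pos_mat n A \<and> pos_prob_vec n r \<and> pos_prob_vec n c \<and> 0 < \<delta> \<longrightarrow>
        (\<exists>B S. proj A r c \<delta> = Some (B, S) \<and>
               (\<exists>x y. (\<forall>i<n. 0 < x i) \<and> (\<forall>j<n. 0 < y j) \<and> B = diag_scale x A y) \<and>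
               ereal (marginal_error B r c) \<le> \<delta>))"


subsection \<open>Sinkhorn\<close>

text \<open>The state consists of $k$, $A^{(k)}$, $x^k$ and $y^k$.\<close>

definition sinkhorn_step ::
  "real mat \<Rightarrow> real vec \<Rightarrow> real vec \<Rightarrow> nat \<times> real mat \<times> real vec \<times> real vec \<Rightarrow>
   (nat \<times> real mat \<times> real vec \<times> real vec) tm" where
  "sinkhorn_step A0 r c = (\<lambda>(k, A, x, y). do {
     k' \<leftarrow> op (k + 1);
     is_odd \<leftarrow> op (odd k');
     (x', y') \<leftarrow>
       (if is_odd
        then do {
          s \<leftarrow> row_sums_tm A;
          x' \<leftarrow> vec_tm (dim_row A0) (\<lambda>i. update_tm (x $ i) (r $ i) (s $ i));
          ret (x', y) }
        else do {
          t \<leftarrow> col_sums_tm A;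
          y' \<leftarrow> vec_tm (dim_col A0) (\<lambda>j. update_tm (y $ j) (c $ j) (t $ j));
          ret (x, y') });
     A' \<leftarrow> mat_tm (dim_row A0) (dim_col A0)
             (\<lambda>i j. scaled_entry_tm (x' $ i) (A0 $$ (i, j)) (y' $ j));
     ret (k', A', x', y')
   })"

definition sinkhorn :: subroutine where
  "sinkhorn A r c \<delta> =
     (case normalize_tm A of (A0, t0) \<Rightarrow>
        map_option (\<lambda>((k, B, x, y), t). (B, t0 + t))
          (while_tm
             (\<lambda>(k, B, x, y). do {
                s \<leftarrow> row_sums_tm B; t \<leftarrow> col_sums_tm B; inaccurate_tm r c \<delta> s t })
             (sinkhorn_step A0 r c)
             (0, A0, 0\<^sub>v (dim_row A), 0\<^sub>v (dim_col A))))"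


subsection \<open>Greenkhorn\<close>

text \<open>
  How ties in the $\arg\max$ are broken is left open: \<open>sel k v\<close> is the index of a maximal
  entry of \<open>v\<close> that is chosen in iteration \<open>k\<close>. The dependence on \<open>k\<close> makes every
  sequence of choices an instance of some selector.
\<close>

definition argmax_selector :: "(nat \<Rightarrow> real vec \<Rightarrow> nat) \<Rightarrow> bool" where
  "argmax_selector sel \<longleftrightarrow>
     (\<forall>k v. 0 < dim_vec v \<longrightarrow> is_arg_max (\<lambda>i. v $ i) (\<lambda>i. i < dim_vec v) (sel k v))"

definition argmax_tm :: "(nat \<Rightarrow> real vec \<Rightarrow> nat) \<Rightarrow> nat \<Rightarrow> real vec \<Rightarrow> nat tm" where
  "argmax_tm sel k v = (sel k v, dim_vec v)"

text \<open>The algorithm without operation count, recomputing the whole matrix in each iteration.\<close>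

definition exp_scale :: "real vec \<Rightarrow> real mat \<Rightarrow> real vec \<Rightarrow> real mat" where
  "exp_scale x A y = diag_scale (\<lambda>i. exp (x $ i)) A (\<lambda>j. exp (y $ j))"

definition greenkhorn_spec ::
  "(nat \<Rightarrow> real vec \<Rightarrow> nat) \<Rightarrow> (nat \<Rightarrow> real vec \<Rightarrow> nat) \<Rightarrow>
   real mat \<Rightarrow> real vec \<Rightarrow> real vec \<Rightarrow> ereal \<Rightarrow> real mat option" where
  "greenkhorn_spec selr selc A r c \<delta> =
     (let A0 = (1 / entry_l1_norm A) \<cdot>\<^sub>m A in
      map_option (\<lambda>(k, B, x, y). B)
        (while_option
           (\<lambda>(k, B, x, y). \<delta> < ereal (marginal_error B r c))
           (\<lambda>(k, B, x, y).
              let s = row_sums B; t = col_sums B;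
                  p = vec (dim_row A) (\<lambda>i. rho (r $ i) (s $ i));
                  q = vec (dim_col A) (\<lambda>j. rho (c $ j) (t $ j));
                  I = selr k p; J = selc k q;
                  (x', y') = (if p $ I > q $ J
                              then (x |\<^sub>v I \<mapsto> x $ I + ln (r $ I / s $ I), y)
                              else (x, y |\<^sub>v J \<mapsto> y $ J + ln (c $ J / t $ J)))
              in (k + 1, exp_scale x' A0 y', x', y'))
           (0, A0, 0\<^sub>v (dim_row A), 0\<^sub>v (dim_col A))))"

text \<open>
  The implementation: an update of $x_I$ changes only row $I$ of the matrix, so the matrix
  \<open>B\<close>, its row sums \<open>s\<close> and its column sums \<open>t\<close> are kept in the state and updated with
  $O(n)$ operations.
\<close>

definition set_row :: "real mat \<Rightarrow> nat \<Rightarrow> real vec \<Rightarrow> real mat" where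
  "set_row B I w = mat (dim_row B) (dim_col B) (\<lambda>(i, j). if i = I then w $ j else B $$ (i, j))"

definition set_col :: "real mat \<Rightarrow> nat \<Rightarrow> real vec \<Rightarrow> real mat" where
  "set_col B J w = mat (dim_row B) (dim_col B) (\<lambda>(i, j). if j = J then w $ i else B $$ (i, j))"

definition adjust_tm :: "real vec \<Rightarrow> real vec \<Rightarrow> real vec \<Rightarrow> real vec tm" where
  "adjust_tm t new old =
     vec_tm (dim_vec t) (\<lambda>j. do { d \<leftarrow> op (new $ j - old $ j); op (t $ j + d) })"

type_synonym greenkhorn_state =
  "nat \<times> real mat \<times> real vec \<times> real vec \<times> real vec \<times> real vec"

definition greenkhorn_step ::
  "(nat \<Rightarrow> real vec \<Rightarrow> nat) \<Rightarrow> (nat \<Rightarrow> real vec \<Rightarrow> nat) \<Rightarrow>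
   real mat \<Rightarrow> real vec \<Rightarrow> real vec \<Rightarrow> greenkhorn_state \<Rightarrow> greenkhorn_state tm" where
  "greenkhorn_step selr selc A0 r c = (\<lambda>(k, B, s, t, x, y). do {
     p \<leftarrow> vec_tm (dim_row A0) (\<lambda>i. rho_tm (r $ i) (s $ i));
     q \<leftarrow> vec_tm (dim_col A0) (\<lambda>j. rho_tm (c $ j) (t $ j));
     I \<leftarrow> argmax_tm selr k p;
     J \<leftarrow> argmax_tm selc k q;
     k' \<leftarrow> op (k + 1);
     is_row \<leftarrow> op (p $ I > q $ J);
     if is_row
     then do {
       u \<leftarrow> update_tm (x $ I) (r $ I) (s $ I);
       w \<leftarrow> vec_tm (dim_col A0) (\<lambda>j. scaled_entry_tm u (A0 $$ (I, j)) (y $ j));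
       m \<leftarrow> sum_tm (dim_col A0) (\<lambda>j. ret (w $ j));
       t' \<leftarrow> adjust_tm t w (row B I);
       ret (k', set_row B I w, s |\<^sub>v I \<mapsto> m, t', x |\<^sub>v I \<mapsto> u, y) }
     else do {
       u \<leftarrow> update_tm (y $ J) (c $ J) (t $ J);
       w \<leftarrow> vec_tm (dim_row A0) (\<lambda>i. scaled_entry_tm (x $ i) (A0 $$ (i, J)) u);
       m \<leftarrow> sum_tm (dim_row A0) (\<lambda>i. ret (w $ i));
       s' \<leftarrow> adjust_tm s w (col B J);
       ret (k', set_col B J w, s', t |\<^sub>v J \<mapsto> m, x, y |\<^sub>v J \<mapsto> u) }
   })"

definition greenkhorn ::
  "(nat \<Rightarrow> real vec \<Rightarrow> nat) \<Rightarrow> (nat \<Rightarrow> real vec \<Rightarrow> nat) \<Rightarrow> subroutine" where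
  "greenkhorn selr selc A r c \<delta> =
     (case do {
             A0 \<leftarrow> normalize_tm A;
             s \<leftarrow> row_sums_tm A0;
             t \<leftarrow> col_sums_tm A0;
             ret (A0, s, t) } of ((A0, s0, t0), m0) \<Rightarrow>
        map_option (\<lambda>((k, B, s, t, x, y), m). (B, m0 + m))
          (while_tm
             (\<lambda>(k, B, s, t, x, y). inaccurate_tm r c \<delta> s t)
             (greenkhorn_step selr selc A0 r c)
             (0, A0, s0, t0, 0\<^sub>v (dim_row A), 0\<^sub>v (dim_col A))))"


section \<open>Rounding and the approximation algorithm\<close>

text \<open>
  Since \<open>a / 0 = 0\<close>, the last line yields \<open>F2\<close> if the row error vanishes; the column error
  then vanishes too if \<open>r\<close> and \<open>c\<close> have the same total mass. If a row or column sum
  vanishes for a nonnegative \<open>F\<close>, then its scaling factor does not matter.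
\<close>

definition round_tm :: "real mat \<Rightarrow> real vec \<Rightarrow> real vec \<Rightarrow> real mat tm" where
  "round_tm F r c = (let m = dim_row F; n = dim_col F in do {
     s \<leftarrow> row_sums_tm F;
     x \<leftarrow> vec_tm m (\<lambda>i. do { q \<leftarrow> op (r $ i / s $ i); op (min q 1) });
     F1 \<leftarrow> mat_tm m n (\<lambda>i j. op (x $ i * F $$ (i, j)));
     t \<leftarrow> col_sums_tm F1;
     y \<leftarrow> vec_tm n (\<lambda>j. do { q \<leftarrow> op (c $ j / t $ j); op (min q 1) });
     F2 \<leftarrow> mat_tm m n (\<lambda>i j. op (F1 $$ (i, j) * y $ j));
     s2 \<leftarrow> row_sums_tm F2;
     t2 \<leftarrow> col_sums_tm F2;
     err_r \<leftarrow> sub_vec_tm r s2;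
     err_c \<leftarrow> sub_vec_tm c t2;
     N \<leftarrow> l1_norm_tm err_r;
     mat_tm m n (\<lambda>i j. do {
       p \<leftarrow> op (err_r $ i * err_c $ j); q \<leftarrow> op (p / N); op (F2 $$ (i, j) + q) })
   })"

text \<open>The input $A = \exp(-\eta C)$ and the accuracy $\varepsilon'$ of the projection.\<close>

definition eta :: "nat \<Rightarrow> real \<Rightarrow> real" where
  "eta n \<epsilon> = 4 * ln (real n) / \<epsilon>"

definition gibbs_kernel :: "real mat \<Rightarrow> real \<Rightarrow> real mat" where
  "gibbs_kernel C \<epsilon> = map_mat (\<lambda>z. exp (- eta (dim_row C) \<epsilon> * z)) C"

definition tolerance :: "real mat \<Rightarrow> real \<Rightarrow> ereal" where
  "tolerance C \<epsilon> = ereal \<epsilon> / ereal (8 * max_norm C)"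

definition setup_tm :: "real mat \<Rightarrow> real \<Rightarrow> (real mat \<times> ereal) tm" where
  "setup_tm C \<epsilon> = (let n = dim_row C in do {
     l \<leftarrow> op (ln (real n));
     l4 \<leftarrow> op (4 * l);
     \<eta> \<leftarrow> op (l4 / \<epsilon>);
     N \<leftarrow> max_tm n (\<lambda>i. max_tm n (\<lambda>j. op \<bar>C $$ (i, j)\<bar>));
     N8 \<leftarrow> op (8 * N);
     \<delta> \<leftarrow> op (ereal \<epsilon> / ereal N8);
     \<eta>' \<leftarrow> op (- \<eta>);
     A \<leftarrow> mat_tm n n (\<lambda>i j. do { z \<leftarrow> op (\<eta>' * C $$ (i, j)); op (exp z) });
     ret (A, \<delta>)
   })"

definition approx_ot ::
  "subroutine \<Rightarrow> real mat \<Rightarrow> real vec \<Rightarrow> real vec \<Rightarrow> real \<Rightarrow> real mat tm option" where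
  "approx_ot proj C r c \<epsilon> =
     (case setup_tm C \<epsilon> of ((A, \<delta>), t0) \<Rightarrow>
      (case proj A r c \<delta> of
         None \<Rightarrow> None
       | Some (B, S) \<Rightarrow>
         (case round_tm B r c of (P, t1) \<Rightarrow> Some (P, t0 + S + t1))))"

end

theory Submission
  imports Defs "HOL-Analysis.Elementary_Metric_Spaces" "HOL-Analysis.Convex"
begin

text \<open>
  Accuracy: a scaling \<open>B\<close> of the Gibbs kernel minimises $\langle P, C\rangle - H(P)/\eta$ over the
  matrices with the marginals of \<open>B\<close>, so it is within $2m\ln n/\eta$ of optimal for its own
  marginals, \<open>m\<close> being its mass. Rounding an optimal plan to the marginals of \<open>B\<close>, and \<open>B\<close> to
  \<open>(r, c)\<close>, each costs at most half the marginal error times $\|C\|_\infty$: since \<open>C\<close> is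
  nonnegative, only the mass added by the rank-one correction counts. This is sharper than the
  $\ell_1$ bound of the rounding step and makes up for \<open>m\<close> exceeding one. When
  $\varepsilon \ge \|C\|_\infty$, every feasible plan is good enough.

  Iteration count: updating the scaling of row \<open>i\<close> lowers the convex dual potential
  $\sum_{ij} A_{ij} e^{x_i + y_j} - \langle r, x\rangle - \langle c, y\rangle$ by exactly
  $\rho(r_i, r_i(A))$, and the potential is bounded below in terms of the least entry. While the
  marginal error exceeds $\delta$, the sum of these divergences over the rows or over the columns
  is at least of order $\min(1, \delta)^2$ by Pinsker's inequality. Sinkhorn gains the whole sum in
  a step of cost $O(n^2)$, Greenkhorn at least the fraction $1/n$ of it in a step of cost $O(n)$.
\<close>

section \<open>A Pinsker inequality for \<open>rho\<close>\<close>

text \<open>The rate cannot hold uniformly in \<epsilon>: set-up and rounding alone cost order n^2,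
  whereas L^3 / \<epsilon>^3 becomes arbitrarily small once \<epsilon> dwarfs \<open>L\<close>.
  Hence the restriction \<epsilon> \<le> \<kappa> \<open>L\<close> and a constant depending on
  \<kappa>. The exponent 3 is one factor L / \<epsilon> from the range of the potential and two from
  the squared accuracy. After normalisation the potential starts at 1 and stays above
  \<open>1 + ln l\<close> for any positive lower bound \<open>l\<close> of the entries; for the
  Gibbs kernel \<open>l\<close> is exp (- \<eta> L) / n^2, so that - ln l = ln n (4 L / \<epsilon> +
  2). The obstacle in both halves is mass. A Greenkhorn step corrects one row or column and does not
  keep the total at one, and the output of an arbitrary projection is normalised only up to its
  marginal error. So Pinsker's inequality is needed for vectors of unknown mass, and the entropy
  argument for a matrix of mass m, which \<epsilon> < \<parallel>C\<parallel> caps at 9/8.\<close>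

lemma rho_ge_sqrt_diff:
  assumes "0 < a" "0 < b"
  shows "(sqrt a - sqrt b)\<^sup>2 \<le> rho a b"
proof -
  \<comment> \<open>The inequality ln t \<le> t - 1 is applied at the square root of b / a, which
    makes the lower bound a perfect square; at b / a itself it would give only the sign of
    \<open>rho\<close>.\<close>
  have "ln (sqrt b / sqrt a) \<le> sqrt b / sqrt a - 1"
    using assms by (intro ln_le_minus_one) auto
  moreover have "ln (sqrt b / sqrt a) = - ln (a / b) / 2"
    using assms by (simp add: ln_div ln_sqrt field_simps)
  ultimately have le: "2 * (1 - sqrt b / sqrt a) \<le> ln (a / b)" by argo
  have "a * (2 * (1 - sqrt b / sqrt a)) = 2 * a - 2 * sqrt a * sqrt b"
  proof -
    have "a * (2 * (1 - sqrt b / sqrt a)) = 2 * a - 2 * (a / sqrt a) * sqrt b"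
      by (simp add: algebra_simps)
    also have "a / sqrt a = sqrt a" using assms by (simp add: real_div_sqrt)
    finally show ?thesis .
  qed
  moreover have "a * (2 * (1 - sqrt b / sqrt a)) \<le> a * ln (a / b)"
    using le assms by (intro mult_left_mono) auto
  ultimately have "2 * a - 2 * sqrt a * sqrt b \<le> a * ln (a / b)" by argo
  then show ?thesis
    using assms unfolding rho_def by (simp add: power2_diff)
qed

lemma rho_nonneg:
  assumes "0 < a" "0 < b"
  shows "0 \<le> rho a b"
  using order_trans[OF zero_le_power2 rho_ge_sqrt_diff[OF assms]] .

text \<open>The Hellinger form of Pinsker's inequality: it does not need \<open>s\<close> to have mass one.\<close>

lemma l1_sq_le_sum_rho:
  fixes r s :: "nat \<Rightarrow> real"
  assumes r: "\<And>i. i < n \<Longrightarrow> 0 < r i" and s: "\<And>i. i < n \<Longrightarrow> 0 < s i"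
    and r1: "(\<Sum>i<n. r i) = 1"
  defines "E \<equiv> (\<Sum>i<n. \<bar>s i - r i\<bar>)"
  shows "E\<^sup>2 \<le> (\<Sum>i<n. rho (r i) (s i)) * (4 + 2 * E)"
proof -
  have "E = (\<Sum>i<n. \<bar>sqrt (s i) - sqrt (r i)\<bar> * (sqrt (s i) + sqrt (r i)))"
    unfolding E_def
  proof (rule sum.cong)
    fix i assume "i \<in> {..<n}"
    then have p: "0 < r i" "0 < s i" using r s by auto
    have "s i - r i = (sqrt (s i) - sqrt (r i)) * (sqrt (s i) + sqrt (r i))"
      using p by (simp add: algebra_simps)
    then show "\<bar>s i - r i\<bar> = \<bar>sqrt (s i) - sqrt (r i)\<bar> * (sqrt (s i) + sqrt (r i))"
      using p by (simp add: abs_mult)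
  qed simp
  \<comment> \<open>Cauchy-Schwarz on the factorisation into difference and sum of square roots: the
    first factor is a squared Hellinger distance, the second is controlled by the masses.\<close>
  then have "E\<^sup>2 \<le> (\<Sum>i<n. \<bar>sqrt (s i) - sqrt (r i)\<bar>\<^sup>2) * (\<Sum>i<n. (sqrt (s i) + sqrt (r i))\<^sup>2)"
    by (simp only: Cauchy_Schwarz_ineq_sum)
  also have "\<dots> \<le> (\<Sum>i<n. rho (r i) (s i)) * (4 + 2 * E)"
  proof (rule mult_mono)
    show "(\<Sum>i<n. \<bar>sqrt (s i) - sqrt (r i)\<bar>\<^sup>2) \<le> (\<Sum>i<n. rho (r i) (s i))"
      using rho_ge_sqrt_diff r s by (intro sum_mono) (simp add: power2_commute)
    \<comment> \<open>As the mass of \<open>s\<close> is unknown, \<open>s i\<close> is traded for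
      \<open>r i\<close> plus the deviation; this is the source of the term linear in
      \<open>E\<close>.\<close>
    have "(\<Sum>i<n. (sqrt (s i) + sqrt (r i))\<^sup>2) \<le> (\<Sum>i<n. 4 * r i + 2 * \<bar>s i - r i\<bar>)"
    proof (rule sum_mono)
      fix i assume "i \<in> {..<n}"
      then have p: "0 < r i" "0 < s i" using r s by auto
      have "0 \<le> (sqrt (s i) - sqrt (r i))\<^sup>2" by simp
      then have "(sqrt (s i) + sqrt (r i))\<^sup>2 \<le> 2 * s i + 2 * r i"
        using p by (simp add: power2_diff power2_sum)
      also have "\<dots> \<le> 4 * r i + 2 * \<bar>s i - r i\<bar>"
        using abs_ge_self[of "s i - r i"] by argo
      finally show "(sqrt (s i) + sqrt (r i))\<^sup>2 \<le> 4 * r i + 2 * \<bar>s i - r i\<bar>" .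
    qed
    also have "\<dots> = 4 + 2 * E"
      using r1 by (simp add: sum.distrib E_def flip: sum_distrib_left)
    finally show "(\<Sum>i<n. (sqrt (s i) + sqrt (r i))\<^sup>2) \<le> 4 + 2 * E" .
    show "0 \<le> (\<Sum>i<n. rho (r i) (s i))"
      using rho_nonneg r s by (intro sum_nonneg) auto
  qed (simp add: sum_nonneg)
  finally show ?thesis .
qed

text \<open>The quotient E^2 / (4 + 2 E) increases with E, so the worst case is E = d / 2, where d
  \<le> 1 leaves at least (d^2 / 4) / 5. The half is there because a marginal error of d puts at
  least d / 2 on the rows or on the columns.\<close>

lemma sum_rho_ge:
  fixes r s :: "nat \<Rightarrow> real"
  assumes "\<And>i. i < n \<Longrightarrow> 0 < r i" "\<And>i. i < n \<Longrightarrow> 0 < s i"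
    and "(\<Sum>i<n. r i) = 1" and d: "0 < d" "d \<le> 1"
    and E: "d / 2 \<le> (\<Sum>i<n. \<bar>s i - r i\<bar>)"
  shows "d\<^sup>2 / 20 \<le> (\<Sum>i<n. rho (r i) (s i))"
proof -
  define E where "E = (\<Sum>i<n. \<bar>s i - r i\<bar>)"
  define R where "R = (\<Sum>i<n. rho (r i) (s i))"
  have "E\<^sup>2 \<le> R * (4 + 2 * E)"
    unfolding E_def R_def by (rule l1_sq_le_sum_rho) (use assms in auto)
  moreover have dE: "d / 2 \<le> E" using E unfolding E_def .
  moreover have "d\<^sup>2 * (4 + 2 * E) \<le> 20 * E\<^sup>2"
  proof -
    have "d * d \<le> 2 * E * (2 * E)" using d dE by (intro mult_mono) auto
    moreover have "d * d * E \<le> 1 * (2 * E) * E"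
      using d dE by (intro mult_right_mono mult_mono) auto
    ultimately show ?thesis by (simp add: power2_eq_square algebra_simps)
  qed
  ultimately have "d\<^sup>2 * (4 + 2 * E) \<le> (20 * R) * (4 + 2 * E)" by linarith
  moreover have "0 < 4 + 2 * E" using d dE by linarith
  ultimately have "d\<^sup>2 \<le> 20 * R" using mult_le_cancel_right_pos by blast
  then show ?thesis unfolding R_def by simp
qed

section \<open>The dual potential\<close>

definition potential ::
  "nat \<Rightarrow> (nat \<Rightarrow> nat \<Rightarrow> real) \<Rightarrow> (nat \<Rightarrow> real) \<Rightarrow> (nat \<Rightarrow> real) \<Rightarrow> (nat \<Rightarrow> real) \<Rightarrow> (nat \<Rightarrow> real) \<Rightarrow> real"
  where "potential n a r c x y =
    (\<Sum>i<n. \<Sum>j<n. a i j * exp (x i + y j)) - (\<Sum>i<n. r i * x i) - (\<Sum>j<n. c j * y j)"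

text \<open>By this symmetry the column update needs no computation of its own.\<close>

lemma potential_transpose:
  "potential n a r c x y = potential n (\<lambda>j i. a i j) c r y x"
  unfolding potential_def
  by (subst sum.swap) (simp add: add.commute)

text \<open>In an updated row the exponential part changes from s_i to r_i and the linear part by -
  r_i ln (r_i / s_i); together this is - \<open>rho\<close>. An arbitrary set \<open>I\<close>
  covers both Sinkhorn, which updates all rows, and Greenkhorn, which updates one.\<close>

lemma potential_row_update:
  assumes a: "\<And>i j. i < n \<Longrightarrow> j < n \<Longrightarrow> 0 < a i j" and r: "\<And>i. i < n \<Longrightarrow> 0 < r i" and n: "0 < n"
    and s: "\<And>i. i < n \<Longrightarrow> s i = (\<Sum>j<n. a i j * exp (x i + y j))"
    and x': "\<And>i. i < n \<Longrightarrow> x' i = (if i \<in> I then x i + ln (r i / s i) else x i)"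
    and I: "I \<subseteq> {..<n}"
  shows "potential n a r c x' y = potential n a r c x y - (\<Sum>i\<in>I. rho (r i) (s i))"
proof -
  have "(\<Sum>j<n. a i j * exp (x' i + y j)) - r i * x' i
      = s i - r i * x i - (if i \<in> I then rho (r i) (s i) else 0)" if i: "i < n" for i
  proof (cases "i \<in> I")
    case True
    have si: "0 < s i"
      unfolding s[OF i] using a i n by (intro sum_pos) auto
    have "(\<Sum>j<n. a i j * exp (x' i + y j)) = exp (ln (r i / s i)) * s i"
      unfolding s[OF i] x'[OF i] sum_distrib_left using True
      by (intro sum.cong) (simp_all add: exp_add s[OF i])
    also have "\<dots> = r i" using si r[OF i] by simp
    finally show ?thesis using True i x' by (simp add: rho_def algebra_simps)
  qed (use i x' s in auto)
  then have "(\<Sum>i<n. (\<Sum>j<n. a i j * exp (x' i + y j)) - r i * x' i)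
    = (\<Sum>i<n. (\<Sum>j<n. a i j * exp (x i + y j)) - r i * x i) - (\<Sum>i\<in>I. rho (r i) (s i))"
    using I s by (simp add: sum_subtractf sum.If_cases Int_absorb1)
  then show ?thesis unfolding potential_def by (simp add: sum_subtractf)
qed

text \<open>The left side is the minimum of the right side over z, attained at z = ln (p / a); the
  proof is the tangent inequality for exp, shifted to that point.\<close>

lemma linear_le_exp:
  fixes p a z :: real
  assumes "0 < p" "0 < a"
  shows "p + p * ln (a / p) \<le> a * exp z - p * z"
proof -
  have "1 + (z + ln (a / p)) \<le> exp (z + ln (a / p))" by (rule exp_ge_add_one_self)
  also have "\<dots> = a / p * exp z" using assms by (simp add: exp_add)
  finally have "p * (1 + (z + ln (a / p))) \<le> p * (a / p * exp z)"
    using assms by (intro mult_left_mono) auto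
  also have "p * (a / p * exp z) = a * exp z" using assms by simp
  finally show ?thesis by (simp add: algebra_simps)
qed

text \<open>Since \<open>r\<close> and \<open>c\<close> have mass one, the linear terms are the
  average of x_i + y_j under the product weights r_i c_j. The potential thereby splits into one
  function per entry, each minimised separately, and r_i c_j \<le> 1 allows its logarithm to be
  dropped.\<close>

lemma potential_ge:
  assumes a: "\<And>i j. i < n \<Longrightarrow> j < n \<Longrightarrow> l \<le> a i j" and l: "0 < l"
    and r: "\<And>i. i < n \<Longrightarrow> 0 < r i" "(\<Sum>i<n. r i) = 1"
    and c: "\<And>i. i < n \<Longrightarrow> 0 < c i" "(\<Sum>i<n. c i) = 1"
  shows "1 + ln l \<le> potential n a r c x y"
proof -
  have le1: "v i \<le> 1" if "\<And>i. i < n \<Longrightarrow> 0 < v i" "(\<Sum>i<n. v i) = 1" "i < n" for v :: "nat \<Rightarrow> real" and i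
    using member_le_sum[of i "{..<n}" v] that by (auto intro: less_imp_le)
  have rc: "(\<Sum>i<n. \<Sum>j<n. r i * c j * k) = k" for k
    using r c by (simp add: sum_product[symmetric] flip: sum_distrib_right)
  have "1 + ln l = (\<Sum>i<n. \<Sum>j<n. r i * c j * (1 + ln l))" by (rule rc[symmetric])
  also have "\<dots> \<le> (\<Sum>i<n. \<Sum>j<n. a i j * exp (x i + y j) - r i * c j * (x i + y j))"
  proof (intro sum_mono)
    fix i j assume "i \<in> {..<n}" "j \<in> {..<n}"
    then have ij: "i < n" "j < n" by auto
    define p where "p = r i * c j"
    have p: "0 < p" "p \<le> 1"
      using r c ij le1[OF r] le1[OF c] unfolding p_def by (auto intro!: mult_le_one intro: less_imp_le)
    have aij: "l \<le> a i j" using a ij by auto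
    have "l \<le> a i j / p"
    proof -
      have "l * p \<le> l * 1" using p l by (intro mult_left_mono) auto
      then show ?thesis using p aij by (simp add: field_simps)
    qed
    then have "ln l \<le> ln (a i j / p)" using l by (metis ln_mono order_less_le_trans)
    then have "p * (1 + ln l) \<le> p + p * ln (a i j / p)"
      using p by (simp add: algebra_simps)
    also have "\<dots> \<le> a i j * exp (x i + y j) - p * (x i + y j)"
      using p aij l by (intro linear_le_exp) auto
    finally show "r i * c j * (1 + ln l) \<le> a i j * exp (x i + y j) - r i * c j * (x i + y j)"
      unfolding p_def .
  qed
  also have "\<dots> = potential n a r c x y"
  proof -
    have "(\<Sum>i<n. \<Sum>j<n. r i * c j * x i) = (\<Sum>i<n. r i * x i) * (\<Sum>j<n. c j)"
      unfolding sum_product by (intro sum.cong) (simp_all add: mult_ac)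
    moreover have "(\<Sum>i<n. \<Sum>j<n. r i * c j * y j) = (\<Sum>i<n. r i) * (\<Sum>j<n. c j * y j)"
      unfolding sum_product by (intro sum.cong) (simp_all add: mult_ac)
    ultimately show ?thesis
      unfolding potential_def by (simp only: r c distrib_left sum_subtractf sum.distrib)
  qed
  finally show ?thesis .
qed

section \<open>Rounding\<close>

text \<open>For the cost bound, the two scalings only shrink entries, so G - F is at most the
  rank-one correction, whose mass is \<open>N\<close>. With m the mass of F and M that of the
  target, the scalings remove at most (E1 + m - M) / 2 and (E2 + m - M) / 2; restoring mass M then
  takes at most (E1 + E2) / 2. The intermediate quantities are hypotheses rather than definitions,
  so that matrices and plain functions can both be plugged in.\<close>

lemma rounding_correct:
  fixes F :: "nat \<Rightarrow> nat \<Rightarrow> real" and r c :: "nat \<Rightarrow> real"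
  assumes F: "\<And>i j. i < n \<Longrightarrow> j < n \<Longrightarrow> 0 \<le> F i j"
    and r: "\<And>i. i < n \<Longrightarrow> 0 \<le> r i" and c: "\<And>j. j < n \<Longrightarrow> 0 \<le> c j"
    and mass: "(\<Sum>i<n. r i) = (\<Sum>j<n. c j)"
    and x: "\<And>i. i < n \<Longrightarrow> x i = min (r i / (\<Sum>j<n. F i j)) 1"
    and F1: "\<And>i j. i < n \<Longrightarrow> j < n \<Longrightarrow> F1 i j = x i * F i j"
    and y: "\<And>j. j < n \<Longrightarrow> y j = min (c j / (\<Sum>i<n. F1 i j)) 1"
    and F2: "\<And>i j. i < n \<Longrightarrow> j < n \<Longrightarrow> F2 i j = F1 i j * y j"
    and er: "\<And>i. i < n \<Longrightarrow> er i = r i - (\<Sum>j<n. F2 i j)"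
    and ec: "\<And>j. j < n \<Longrightarrow> ec j = c j - (\<Sum>i<n. F2 i j)"
    and G: "\<And>i j. i < n \<Longrightarrow> j < n \<Longrightarrow> G i j = F2 i j + er i * ec j / (\<Sum>i<n. \<bar>er i\<bar>)"
  shows "\<And>i j. i < n \<Longrightarrow> j < n \<Longrightarrow> 0 \<le> G i j"
    and "\<And>i. i < n \<Longrightarrow> (\<Sum>j<n. G i j) = r i"
    and "\<And>j. j < n \<Longrightarrow> (\<Sum>i<n. G i j) = c j"
    and "\<And>C L. 0 \<le> L \<Longrightarrow> (\<And>i j. i < n \<Longrightarrow> j < n \<Longrightarrow> 0 \<le> C i j \<and> C i j \<le> L) \<Longrightarrow>
      (\<Sum>i<n. \<Sum>j<n. (G i j - F i j) * C i j) \<le>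
      L * ((\<Sum>i<n. \<bar>(\<Sum>j<n. F i j) - r i\<bar>) + (\<Sum>j<n. \<bar>(\<Sum>i<n. F i j) - c j\<bar>)) / 2"
proof -
  \<comment> \<open>The third bound is the positive part of b - a. For b = 0 the quotient is 0 by
    convention, and both sides of the identity with \<open>min a b\<close> vanish.\<close>
  have scale: "0 \<le> min (a / b) 1" "min (a / b) 1 * b \<le> a"
    "b - min (a / b) 1 * b \<le> (\<bar>b - a\<bar> + (b - a)) / 2"
    if "0 \<le> a" "0 \<le> b" for a b :: real
  proof -
    show "0 \<le> min (a / b) 1" using that by simp
    have "min (a / b) 1 * b = min a b"
      using that by (cases "b = 0") (auto simp: min_def field_simps)
    then show "min (a / b) 1 * b \<le> a" "b - min (a / b) 1 * b \<le> (\<bar>b - a\<bar> + (b - a)) / 2"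
      by (auto simp: min_def)
  qed
  have x01: "0 \<le> x i" "x i \<le> 1" if "i < n" for i
    using x[OF that] r[OF that] F that by (auto intro!: divide_nonneg_nonneg sum_nonneg)
  have F1_nonneg: "0 \<le> F1 i j" and F1_le: "F1 i j \<le> F i j" if "i < n" "j < n" for i j
    using F1[OF that] x01 F that by (auto intro: mult_left_le_one_le)
  have y01: "0 \<le> y j" "y j \<le> 1" if "j < n" for j
    using y[OF that] c[OF that] F1_nonneg that by (auto intro!: divide_nonneg_nonneg sum_nonneg)
  have F2_nonneg: "0 \<le> F2 i j" and F2_le: "F2 i j \<le> F1 i j" if "i < n" "j < n" for i j
    using F2[OF that] y01 F1_nonneg that by (auto intro: mult_right_le_one_le)
  have row1: "(\<Sum>j<n. F1 i j) = min (r i / (\<Sum>j<n. F i j)) 1 * (\<Sum>j<n. F i j)" if "i < n" for i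
    using that F1 x by (simp add: sum_distrib_left)
  have col2: "(\<Sum>i<n. F2 i j) = min (c j / (\<Sum>i<n. F1 i j)) 1 * (\<Sum>i<n. F1 i j)" if "j < n" for j
    unfolding y[OF that, symmetric] sum_distrib_left using that F2 by (simp add: mult.commute)
  have er_nonneg: "0 \<le> er i" if i: "i < n" for i
  proof -
    have "(\<Sum>j<n. F2 i j) \<le> (\<Sum>j<n. F1 i j)" using F2_le i by (intro sum_mono) auto
    also have "\<dots> \<le> r i" unfolding row1[OF i] using r F i by (intro scale) (auto intro: sum_nonneg)
    finally show ?thesis using er i by simp
  qed
  have ec_nonneg: "0 \<le> ec j" if j: "j < n" for j
  proof -
    have "(\<Sum>i<n. F2 i j) \<le> c j"
      unfolding col2[OF j] using c F1_nonneg j by (intro scale) (auto intro: sum_nonneg)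
    then show ?thesis using ec j by simp
  qed
  define N where "N = (\<Sum>i<n. er i)"
  have N_abs: "(\<Sum>i<n. \<bar>er i\<bar>) = N"
    unfolding N_def using er_nonneg by (intro sum.cong) auto
  have N_r: "N = (\<Sum>i<n. r i) - (\<Sum>i<n. \<Sum>j<n. F2 i j)"
    unfolding N_def using er by (simp add: sum_subtractf)
  have N_ec: "N = (\<Sum>j<n. ec j)"
  proof -
    have "(\<Sum>j<n. ec j) = (\<Sum>j<n. c j) - (\<Sum>j<n. \<Sum>i<n. F2 i j)"
      using ec by (simp add: sum_subtractf)
    then show ?thesis using N_r mass sum.swap[of "\<lambda>i j. F2 i j" "{..<n}" "{..<n}"] by simp
  qed
  have N_nonneg: "0 \<le> N" unfolding N_def using er_nonneg by (auto intro: sum_nonneg)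
  \<comment> \<open>If N = 0, division by it gives 0, but all errors vanish as well, so the
    correction still restores the marginals.\<close>
  have er0: "er i * N / N = er i" if "i < n" for i
  proof (cases "N = 0")
    case True
    then have "er i = 0"
      using that er_nonneg unfolding N_def by (subst (asm) sum_nonneg_eq_0_iff) auto
    then show ?thesis by simp
  qed simp
  have ec0: "ec j * N / N = ec j" if "j < n" for j
  proof (cases "N = 0")
    case True
    then have "ec j = 0"
      using that ec_nonneg unfolding N_ec by (subst (asm) sum_nonneg_eq_0_iff) auto
    then show ?thesis by simp
  qed simp
  have G': "G i j = F2 i j + er i * ec j / N" if "i < n" "j < n" for i j
    using G[OF that] unfolding N_abs .
  show "0 \<le> G i j" if "i < n" "j < n" for i j
    using G'[OF that] F2_nonneg er_nonneg ec_nonneg N_nonneg that by auto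
  show "(\<Sum>j<n. G i j) = r i" if i: "i < n" for i
  proof -
    have "(\<Sum>j<n. G i j) = (\<Sum>j<n. F2 i j) + er i * N / N"
      using G' i unfolding N_ec by (simp add: sum.distrib sum_distrib_left sum_divide_distrib)
    then show ?thesis using er0[OF i] er[OF i] by simp
  qed
  show "(\<Sum>i<n. G i j) = c j" if j: "j < n" for j
  proof -
    have "(\<Sum>i<n. G i j) = (\<Sum>i<n. F2 i j) + ec j * N / N"
      using G' j unfolding N_def
      by (simp add: sum.distrib sum_distrib_left sum_divide_distrib mult.commute)
    then show ?thesis using ec0[OF j] ec[OF j] by simp
  qed
  fix C :: "nat \<Rightarrow> nat \<Rightarrow> real" and L :: real
  assume L: "0 \<le> L" and C: "\<And>i j. i < n \<Longrightarrow> j < n \<Longrightarrow> 0 \<le> C i j \<and> C i j \<le> L"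
  show "(\<Sum>i<n. \<Sum>j<n. (G i j - F i j) * C i j) \<le>
      L * ((\<Sum>i<n. \<bar>(\<Sum>j<n. F i j) - r i\<bar>) + (\<Sum>j<n. \<bar>(\<Sum>i<n. F i j) - c j\<bar>)) / 2"
  proof -
    define E1 where "E1 = (\<Sum>i<n. \<bar>(\<Sum>j<n. F i j) - r i\<bar>)"
    define E2 where "E2 = (\<Sum>j<n. \<bar>(\<Sum>i<n. F i j) - c j\<bar>)"
    define m where "m = (\<Sum>i<n. \<Sum>j<n. F i j)"
    define M where "M = (\<Sum>i<n. r i)"
    have "(\<Sum>i<n. (\<Sum>j<n. F i j) - (\<Sum>j<n. F1 i j))
        \<le> (\<Sum>i<n. (\<bar>(\<Sum>j<n. F i j) - r i\<bar> + ((\<Sum>j<n. F i j) - r i)) / 2)"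
    proof (rule sum_mono)
      fix i assume "i \<in> {..<n}"
      then have i: "i < n" by simp
      show "(\<Sum>j<n. F i j) - (\<Sum>j<n. F1 i j)
          \<le> (\<bar>(\<Sum>j<n. F i j) - r i\<bar> + ((\<Sum>j<n. F i j) - r i)) / 2"
        unfolding row1[OF i] using r F i by (intro scale) (auto intro: sum_nonneg)
    qed
    then have lost1: "m - (\<Sum>i<n. \<Sum>j<n. F1 i j) \<le> (E1 + (m - M)) / 2"
      unfolding E1_def m_def M_def by (simp add: sum.distrib sum_subtractf flip: sum_divide_distrib)
    have "(\<Sum>j<n. (\<Sum>i<n. F1 i j) - (\<Sum>i<n. F2 i j))
        \<le> (\<Sum>j<n. (\<bar>(\<Sum>i<n. F i j) - c j\<bar> + ((\<Sum>i<n. F i j) - c j)) / 2)"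
    proof (rule sum_mono)
      fix j assume "j \<in> {..<n}"
      then have j: "j < n" by simp
      have "(\<Sum>i<n. F1 i j) - (\<Sum>i<n. F2 i j)
          \<le> (\<bar>(\<Sum>i<n. F1 i j) - c j\<bar> + ((\<Sum>i<n. F1 i j) - c j)) / 2"
        unfolding col2[OF j] using c F1_nonneg j by (intro scale) (auto intro: sum_nonneg)
      \<comment> \<open>The positive part is monotone and the first scaling lowers column sums, so
        the column excess may be measured on F instead of F1.\<close>
      also have "\<dots> \<le> (\<bar>(\<Sum>i<n. F i j) - c j\<bar> + ((\<Sum>i<n. F i j) - c j)) / 2"
      proof -
        have "(\<Sum>i<n. F1 i j) \<le> (\<Sum>i<n. F i j)" using F1_le j by (intro sum_mono) auto
        then show ?thesis by (auto simp: abs_if)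
      qed
      finally show "(\<Sum>i<n. F1 i j) - (\<Sum>i<n. F2 i j)
          \<le> (\<bar>(\<Sum>i<n. F i j) - c j\<bar> + ((\<Sum>i<n. F i j) - c j)) / 2" .
    qed
    then have lost2: "(\<Sum>i<n. \<Sum>j<n. F1 i j) - (\<Sum>i<n. \<Sum>j<n. F2 i j) \<le> (E2 + (m - M)) / 2"
      unfolding E2_def m_def M_def mass
      by (simp add: sum.distrib sum_subtractf sum.swap[of "\<lambda>i j. F i j"] sum.swap[of "\<lambda>i j. F1 i j"]
          sum.swap[of "\<lambda>i j. F2 i j"] flip: sum_divide_distrib)
    have N_le: "N \<le> (E1 + E2) / 2"
      using lost1 lost2 N_r unfolding M_def[symmetric] by argo
    have "(\<Sum>i<n. \<Sum>j<n. (G i j - F i j) * C i j) \<le> (\<Sum>i<n. \<Sum>j<n. er i * ec j / N * L)"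
    proof (intro sum_mono)
      fix i j assume "i \<in> {..<n}" "j \<in> {..<n}"
      then have ij: "i < n" "j < n" by auto
      have "G i j - F i j \<le> er i * ec j / N"
        using G'[OF ij] F1_le[OF ij] F2_le[OF ij] by linarith
      then have "(G i j - F i j) * C i j \<le> er i * ec j / N * C i j"
        using C[OF ij] by (intro mult_right_mono) auto
      also have "\<dots> \<le> er i * ec j / N * L"
        using C[OF ij] er_nonneg ec_nonneg N_nonneg ij by (intro mult_left_mono) auto
      finally show "(G i j - F i j) * C i j \<le> er i * ec j / N * L" .
    qed
    also have "\<dots> = (\<Sum>i<n. er i) * (\<Sum>j<n. ec j) / N * L"
      unfolding sum_product by (simp only: sum_divide_distrib sum_distrib_right)
    also have "\<dots> = L * N"
      unfolding N_def[symmetric] N_ec[symmetric] by simp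
    also have "\<dots> \<le> L * ((E1 + E2) / 2)"
      using N_le L by (intro mult_left_mono)
    finally show ?thesis
      unfolding E1_def E2_def by simp
  qed
qed

section \<open>Entropic optimality of scalings of the Gibbs kernel\<close>

text \<open>For given mass the entropy is largest at the uniform vector with entries m / |S|. The
  comparison is made entry by entry with ln t \<le> t - 1, whose linear terms cancel in the
  sum.\<close>

lemma neg_entropy_ge:
  fixes b :: "'a \<Rightarrow> real"
  assumes "finite S" "S \<noteq> {}" and b: "\<And>s. s \<in> S \<Longrightarrow> 0 < b s"
  defines "m \<equiv> sum b S"
  shows "m * ln m - m * ln (card S) \<le> (\<Sum>s\<in>S. b s * ln (b s))"
proof -
  have m: "0 < m" unfolding m_def using assms by (intro sum_pos) auto
  have N: "0 < card S" using assms by auto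
  have "0 = (\<Sum>s\<in>S. b s - m / card S)"
    using N by (simp add: sum_subtractf m_def)
  also have "\<dots> \<le> (\<Sum>s\<in>S. b s * ln (b s) - b s * (ln m - ln (card S)))"
  proof (rule sum_mono)
    fix s assume "s \<in> S"
    then have bs: "0 < b s" using b by auto
    have "ln (m / card S / b s) \<le> m / card S / b s - 1"
      using m N bs by (intro ln_le_minus_one) auto
    moreover have "ln (m / card S / b s) = ln m - ln (card S) - ln (b s)"
      using m N bs by (simp add: ln_div ln_mult)
    ultimately have "b s * (ln m - ln (card S) - ln (b s)) \<le> b s * (m / card S / b s - 1)"
      using bs by (intro mult_left_mono) auto
    also have "\<dots> = m / card S - b s" using bs by (simp add: field_simps)
    finally show "b s - m / card S \<le> b s * ln (b s) - b s * (ln m - ln (card S))"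
      by (simp add: algebra_simps)
  qed
  also have "\<dots> = (\<Sum>s\<in>S. b s * ln (b s)) - m * (ln m - ln (card S))"
    by (simp add: sum_subtractf m_def sum_distrib_right)
  finally show ?thesis by (simp add: algebra_simps)
qed

text \<open>Taking logarithms, \<eta> C_ij = ln u_i + ln v_j - ln B_ij. Against B - P the terms in u
  and v vanish because the marginals agree, and only P ln B - B ln B remains.\<close>

lemma gibbs_scaling_near_optimal:
  fixes B P C :: "nat \<Rightarrow> nat \<Rightarrow> real"
  assumes n: "0 < n" and B: "\<And>i j. i < n \<Longrightarrow> j < n \<Longrightarrow> B i j = u i * exp (- \<eta> * C i j) * v j"
    and u: "\<And>i. i < n \<Longrightarrow> 0 < u i" and v: "\<And>j. j < n \<Longrightarrow> 0 < v j"
    and P: "\<And>i j. i < n \<Longrightarrow> j < n \<Longrightarrow> 0 \<le> P i j"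
    and rows: "\<And>i. i < n \<Longrightarrow> (\<Sum>j<n. P i j) = (\<Sum>j<n. B i j)"
    and cols: "\<And>j. j < n \<Longrightarrow> (\<Sum>i<n. P i j) = (\<Sum>i<n. B i j)"
  shows "\<eta> * (\<Sum>i<n. \<Sum>j<n. (B i j - P i j) * C i j) \<le> 2 * ln n * (\<Sum>i<n. \<Sum>j<n. B i j)"
proof -
  define m where "m = (\<Sum>i<n. \<Sum>j<n. B i j)"
  have Bpos: "0 < B i j" if "i < n" "j < n" for i j using B u v that by simp
  have mP: "(\<Sum>i<n. \<Sum>j<n. P i j) = m" unfolding m_def using rows by simp
  have lnB: "\<eta> * ((B i j - P i j) * C i j)
      = (B i j - P i j) * ln (u i) + (B i j - P i j) * ln (v j) + P i j * ln (B i j) - B i j * ln (B i j)"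
    if "i < n" "j < n" for i j
  proof -
    have e: "\<eta> * C i j = ln (u i) + ln (v j) - ln (B i j)"
      using B[OF that] u[OF that(1)] v[OF that(2)] by (simp add: ln_mult)
    have "\<eta> * ((B i j - P i j) * C i j) = (B i j - P i j) * (\<eta> * C i j)" by simp
    then show ?thesis unfolding e by (simp add: algebra_simps)
  qed
  have "\<eta> * (\<Sum>i<n. \<Sum>j<n. (B i j - P i j) * C i j)
      = (\<Sum>i<n. \<Sum>j<n. (B i j - P i j) * ln (u i)) + (\<Sum>i<n. \<Sum>j<n. (B i j - P i j) * ln (v j))
        + (\<Sum>i<n. \<Sum>j<n. P i j * ln (B i j)) - (\<Sum>i<n. \<Sum>j<n. B i j * ln (B i j))"
    unfolding sum_distrib_left using lnB by (simp add: sum.distrib sum_subtractf)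
  also have "(\<Sum>i<n. \<Sum>j<n. (B i j - P i j) * ln (u i)) = 0"
    using rows by (simp add: sum_subtractf flip: sum_distrib_right)
  also have "(\<Sum>i<n. \<Sum>j<n. (B i j - P i j) * ln (v j)) = 0"
    by (subst sum.swap) (use cols in \<open>simp add: sum_subtractf flip: sum_distrib_right\<close>)
  \<comment> \<open>Bounding each entry of B by the total mass is crude but enough, and it avoids
    logarithms of P, whose entries may be 0.\<close>
  also have "(\<Sum>i<n. \<Sum>j<n. P i j * ln (B i j)) \<le> (\<Sum>i<n. \<Sum>j<n. P i j * ln m)"
  proof (intro sum_mono mult_left_mono)
    fix i j assume "i \<in> {..<n}" "j \<in> {..<n}"
    then have ij: "i < n" "j < n" by auto
    show "0 \<le> P i j" using P ij .
    have "B i j \<le> (\<Sum>j<n. B i j)" using Bpos ij by (intro member_le_sum) (auto intro: less_imp_le)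
    also have "\<dots> \<le> m" unfolding m_def
      using Bpos ij by (intro member_le_sum[of i]) (auto intro!: sum_nonneg intro: less_imp_le)
    finally show "ln (B i j) \<le> ln m" using Bpos[OF ij] by simp
  qed
  also have "(\<Sum>i<n. \<Sum>j<n. P i j * ln m) = m * ln m"
    using mP by (simp flip: sum_distrib_right)
  finally have "\<eta> * (\<Sum>i<n. \<Sum>j<n. (B i j - P i j) * C i j)
      \<le> m * ln m - (\<Sum>i<n. \<Sum>j<n. B i j * ln (B i j))" by simp
  moreover have "m * ln m - m * (2 * ln n) \<le> (\<Sum>i<n. \<Sum>j<n. B i j * ln (B i j))"
  proof -
    have "ln (real (card ({..<n} \<times> {..<n}))) = 2 * ln n"
      using n by (simp add: card_cartesian_product ln_mult)
    moreover have "{..<n} \<noteq> {}" using n by auto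
    ultimately show ?thesis
      using neg_entropy_ge[of "{..<n} \<times> {..<n}" "\<lambda>(i, j). B i j"] Bpos n
      by (auto simp: m_def sum.cartesian_product case_prod_unfold)
  qed
  ultimately show ?thesis unfolding m_def[symmetric] by (simp add: algebra_simps)
qed

section \<open>Matrices\<close>

lemma row_sums_index [simp]:
  "i < dim_row A \<Longrightarrow> row_sums A $ i = (\<Sum>j<dim_col A. A $$ (i, j))"
  by (simp add: row_sums_def scalar_prod_def lessThan_atLeast0)

lemma col_sums_index [simp]:
  "j < dim_col A \<Longrightarrow> col_sums A $ j = (\<Sum>i<dim_row A. A $$ (i, j))"
  by (simp add: col_sums_def scalar_prod_def lessThan_atLeast0)

lemma dim_row_sums [simp]: "dim_vec (row_sums A) = dim_row A"
  by (simp add: row_sums_def)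

lemma dim_col_sums [simp]: "dim_vec (col_sums A) = dim_col A"
  by (simp add: col_sums_def)

lemma transport_polytope_iff:
  assumes "r \<in> carrier_vec n" "c \<in> carrier_vec n"
  shows "P \<in> transport_polytope n r c \<longleftrightarrow>
    P \<in> carrier_mat n n \<and> (\<forall>i<n. \<forall>j<n. 0 \<le> P $$ (i, j)) \<and>
    (\<forall>i<n. (\<Sum>j<n. P $$ (i, j)) = r $ i) \<and> (\<forall>j<n. (\<Sum>i<n. P $$ (i, j)) = c $ j)"
proof -
  have "row_sums P = r \<longleftrightarrow> (\<forall>i<n. (\<Sum>j<n. P $$ (i, j)) = r $ i)"
    "col_sums P = c \<longleftrightarrow> (\<forall>j<n. (\<Sum>i<n. P $$ (i, j)) = c $ j)"
    if "P \<in> carrier_mat n n"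
    using assms that by (auto intro!: eq_vecI)
  then show ?thesis by (auto simp: transport_polytope_def nonneg_mat_def)
qed

lemma marginal_error_eq:
  assumes "A \<in> carrier_mat n n" "r \<in> carrier_vec n" "c \<in> carrier_vec n"
  shows "marginal_error A r c =
    (\<Sum>i<n. \<bar>(\<Sum>j<n. A $$ (i, j)) - r $ i\<bar>) + (\<Sum>j<n. \<bar>(\<Sum>i<n. A $$ (i, j)) - c $ j\<bar>)"
  using assms by (auto simp: marginal_error_def l1_norm_def)

lemma diag_scale_eq:
  "diag_scale x A y = mat (dim_row A) (dim_col A) (\<lambda>(i, j). x i * A $$ (i, j) * y j)"
  unfolding diag_scale_def
  by (subst mat_diag_mult_left[of _ _ "dim_col A"], simp)
     (subst mat_diag_mult_right[of _ "dim_row A"], auto intro!: eq_matI)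

lemma entry_le_max_norm:
  assumes "i < dim_row A" "j < dim_col A"
  shows "\<bar>A $$ (i, j)\<bar> \<le> max_norm A"
  unfolding max_norm_def
  using assms by (intro Max_ge imageI elements_matI[OF carrier_matI]) (auto simp: elements_mat_def)

text \<open>Compactness in coordinates: along a minimising sequence all entries lie in [0, 1], a
  subsequence converges entrywise, and the finitely many constraints and the linear cost pass to the
  limit.\<close>

lemma transport_polytope_min_exists:
  assumes r: "pos_prob_vec n r" and c: "pos_prob_vec n c" and C: "nonneg_mat n C"
  shows "\<exists>Q. is_arg_min (\<lambda>R. frob R C) (\<lambda>R. R \<in> transport_polytope n r c) Q"
proof -
  note iff = transport_polytope_iff[of r n c]
  have rc: "r \<in> carrier_vec n" "c \<in> carrier_vec n" using r c by (auto simp: pos_prob_vec_def)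
  define S where "S = (\<lambda>P. frob P C) ` transport_polytope n r c"
  have frob: "frob P C = (\<Sum>i<n. \<Sum>j<n. P $$ (i, j) * C $$ (i, j))" if "P \<in> carrier_mat n n" for P
    using that by (simp add: frob_def)
  \<comment> \<open>The independent coupling shows that the polytope is not empty.\<close>
  have "mat n n (\<lambda>(i, j). r $ i * c $ j) \<in> transport_polytope n r c"
    using r c unfolding iff[OF rc]
    by (auto simp: pos_prob_vec_def less_imp_le simp flip: sum_distrib_left sum_distrib_right)
  then have ne: "S \<noteq> {}" unfolding S_def by auto
  have bdd: "bdd_below S"
    unfolding S_def bdd_below_def using C
    by (intro exI[of _ 0]) (auto simp: iff[OF rc] frob nonneg_mat_def intro!: sum_nonneg)
  have "\<exists>P. P \<in> transport_polytope n r c \<and> frob P C < Inf S + inverse (Suc k)" for k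
    using cInf_lessD[OF ne, of "Inf S + inverse (Suc k)"] unfolding S_def by auto
  then obtain P where P: "\<And>k. P k \<in> transport_polytope n r c"
    and P_lt: "\<And>k. frob (P k) C < Inf S + inverse (Suc k)" by metis
  have Pn: "P k \<in> carrier_mat n n" for k using P iff[OF rc] by auto
  define B where "B = {..<n} \<times> {..<n}"
  define f where "f k = (\<lambda>ij. P k $$ ij)" for k
  have bounded: "bounded ((\<lambda>g. g ij) ` range f)" if "ij \<in> B" for ij
  proof (rule boundedI[where B = 1])
    fix z assume "z \<in> (\<lambda>g. g ij) ` range f"
    then obtain k where z: "z = P k $$ ij" unfolding f_def by auto
    obtain i j where ij: "ij = (i, j)" "i < n" "j < n" using \<open>ij \<in> B\<close> unfolding B_def by auto
    have nn: "\<forall>i<n. \<forall>j<n. 0 \<le> P k $$ (i, j)" using P[of k] iff[OF rc] by auto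
    have "P k $$ (i, j) \<le> (\<Sum>j<n. P k $$ (i, j))" using nn ij by (intro member_le_sum) auto
    also have "\<dots> = r $ i" using P[of k] iff[OF rc] ij by auto
    also have "\<dots> \<le> (\<Sum>i<n. r $ i)"
      using r ij by (intro member_le_sum) (auto simp: pos_prob_vec_def intro: less_imp_le)
    also have "\<dots> = 1" using r by (simp add: pos_prob_vec_def)
    finally show "norm z \<le> 1" using z ij nn by simp
  qed
  \<comment> \<open>Functions on the finite index set are their own coordinates, hence the identity
    for both maps; the result is one subsequence that serves all entries at once.\<close>
  have "\<forall>\<delta>\<subseteq>B. \<exists>l r. strict_mono r \<and>
      (\<forall>e>0. \<forall>\<^sub>F k in sequentially. \<forall>ij\<in>\<delta>. dist (f (r k) ij) (l ij) < e)"
    by (rule compact_lemma_general[where proj = "\<lambda>g. g" and unproj = "\<lambda>g. g"])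
       (use bounded in \<open>auto simp: B_def\<close>)
  then have "\<exists>l r. strict_mono r \<and>
      (\<forall>e>0. \<forall>\<^sub>F k in sequentially. \<forall>ij\<in>B. dist (f (r k) ij) (l ij) < e)"
    by (rule allE[of _ B]) simp
  then obtain l and \<sigma> :: "nat \<Rightarrow> nat" where \<sigma>: "strict_mono \<sigma>"
    and l: "\<forall>e>0. \<forall>\<^sub>F k in sequentially. \<forall>ij\<in>B. dist (f (\<sigma> k) ij) (l ij) < e"
    by (elim exE conjE)
  have lim: "(\<lambda>k. P (\<sigma> k) $$ (i, j)) \<longlonglongrightarrow> l (i, j)" if "i < n" "j < n" for i j
  proof (rule tendstoI)
    fix e :: real assume "e > 0"
    from l[rule_format, OF this] show "\<forall>\<^sub>F k in sequentially. dist (P (\<sigma> k) $$ (i, j)) (l (i, j)) < e"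
      by (rule eventually_mono) (use that in \<open>auto simp: B_def f_def\<close>)
  qed
  define Q where "Q = mat n n l"
  have Qn: "Q \<in> carrier_mat n n" unfolding Q_def by simp
  have Qi: "Q $$ (i, j) = l (i, j)" if "i < n" "j < n" for i j using that unfolding Q_def by simp
  have Q: "Q \<in> transport_polytope n r c"
    unfolding iff[OF rc]
  proof (intro conjI allI impI Qn)
    fix i j assume ij: "i < n" "j < n"
    show "0 \<le> Q $$ (i, j)" unfolding Qi[OF ij]
      by (rule LIMSEQ_le_const[OF lim[OF ij]]) (use P ij iff[OF rc] in auto)
  next
    fix i assume i: "i < n"
    have "(\<lambda>k. \<Sum>j<n. P (\<sigma> k) $$ (i, j)) \<longlonglongrightarrow> (\<Sum>j<n. Q $$ (i, j))"
      using lim i Qi by (intro tendsto_sum) auto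
    moreover have "(\<lambda>k. \<Sum>j<n. P (\<sigma> k) $$ (i, j)) = (\<lambda>k. r $ i)" using P i iff[OF rc] by auto
    ultimately show "(\<Sum>j<n. Q $$ (i, j)) = r $ i" by (simp add: LIMSEQ_const_iff)
  next
    fix j assume j: "j < n"
    have "(\<lambda>k. \<Sum>i<n. P (\<sigma> k) $$ (i, j)) \<longlonglongrightarrow> (\<Sum>i<n. Q $$ (i, j))"
      using lim j Qi by (intro tendsto_sum) auto
    moreover have "(\<lambda>k. \<Sum>i<n. P (\<sigma> k) $$ (i, j)) = (\<lambda>k. c $ j)" using P j iff[OF rc] by auto
    ultimately show "(\<Sum>i<n. Q $$ (i, j)) = c $ j" by (simp add: LIMSEQ_const_iff)
  qed
  have "(\<lambda>k. frob (P (\<sigma> k)) C) \<longlonglongrightarrow> frob Q C"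
    unfolding frob[OF Pn] frob[OF Qn]
    by (intro tendsto_intros) (use lim Qi in auto)
  moreover have "(\<lambda>k. Inf S + inverse (real (Suc (\<sigma> k)))) \<longlonglongrightarrow> Inf S + 0"
    by (intro tendsto_intros LIMSEQ_subseq_LIMSEQ[OF LIMSEQ_inverse_real_of_nat \<sigma>, unfolded o_def])
  ultimately have "frob Q C \<le> Inf S + 0"
    by (rule LIMSEQ_le) (use P_lt in \<open>auto intro: less_imp_le\<close>)
  then have "frob Q C \<le> frob R C" if "R \<in> transport_polytope n r c" for R
    using cInf_lower[OF _ bdd, of "frob R C"] that unfolding S_def by auto
  then show ?thesis using Q unfolding is_arg_min_linorder by blast
qed

section \<open>Operation counts\<close>

text \<open>Every iteration lowers \<phi> by at least D while \<phi> stays above \<open>lo\<close>,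
  so there are at most (\<phi> s - lo) / D of them, each costing at most K.\<close>

lemma while_option_potential:
  fixes \<phi> :: "'s \<Rightarrow> real"
  assumes inv: "\<And>s. I s \<Longrightarrow> fst (b s) \<Longrightarrow> I (fst (f s))"
    and dec: "\<And>s. I s \<Longrightarrow> fst (b s) \<Longrightarrow> \<phi> (fst (f s)) + D \<le> \<phi> s"
    and lo: "\<And>s. I s \<Longrightarrow> lo \<le> \<phi> s" and D: "0 < D"
    and cost: "\<And>s. I s \<Longrightarrow> real (snd (b s) + snd (f s)) \<le> K"
    and I: "I s"
  shows "\<exists>s' t'. while_option (\<lambda>(s, t). fst (b s)) (\<lambda>(s, t). (fst (f s), t + snd (b s) + snd (f s))) (s, t)
      = Some (s', t') \<and> I s' \<and> \<not> fst (b s') \<and> real t' \<le> real t + K * ((\<phi> s - lo) / D)"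
    (is "\<exists>s' t'. ?W (s, t) = _ \<and> _")
proof -
  have K: "0 \<le> K" using cost[OF I] by linarith
  \<comment> \<open>The number N serves only as induction measure; for N = 0 the premise contradicts
    the lower bound on \<phi>. The time bound does not mention N, so any sufficiently large N will
    do.\<close>
  have "\<exists>s' t'. ?W (s, t) = Some (s', t') \<and> I s' \<and> \<not> fst (b s') \<and>
      real t' \<le> real t + K * ((\<phi> s - lo) / D)"
    if "\<phi> s < lo + real N * D" "I s" for N
    using that
  proof (induction N arbitrary: s t)
    case 0
    then show ?case using lo[of s] by simp
  next
    case (Suc N)
    show ?case
    proof (cases "fst (b s)")
      case False
      have "?W (s, t) = Some (s, t)" by (subst while_option_unfold) (simp add: False)
      moreover have "0 \<le> K * ((\<phi> s - lo) / D)" using K D lo[OF \<open>I s\<close>] by simp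
      ultimately show ?thesis using False Suc.prems by auto
    next
      case True
      let ?s = "fst (f s)" and ?t = "t + snd (b s) + snd (f s)"
      have I': "I ?s" using inv Suc.prems True by blast
      have dec': "\<phi> ?s + D \<le> \<phi> s" using dec Suc.prems True by blast
      then have "\<phi> ?s < lo + real N * D" using Suc.prems by (simp add: algebra_simps)
      from Suc.IH[OF this I', of ?t] obtain s' t' where W: "?W (?s, ?t) = Some (s', t')"
        and s': "I s'" "\<not> fst (b s')"
        and t': "real t' \<le> real ?t + K * ((\<phi> ?s - lo) / D)" by blast
      have "?W (s, t) = Some (s', t')" by (subst while_option_unfold) (simp add: True W)
      moreover have "real t' \<le> real t + K * ((\<phi> s - lo) / D)"
      proof -
        have "(\<phi> ?s - lo) / D \<le> (\<phi> s - lo) / D - 1" using dec' D by (simp add: field_simps)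
        then have "K * ((\<phi> ?s - lo) / D) \<le> K * ((\<phi> s - lo) / D - 1)" using K by (rule mult_left_mono)
        also have "\<dots> = K * ((\<phi> s - lo) / D) - K" by (simp add: right_diff_distrib)
        finally show ?thesis using t' cost[OF Suc.prems(2)] by simp
      qed
      ultimately show ?thesis using s' by blast
    qed
  qed
  moreover obtain N where "(\<phi> s - lo) / D < real N" using reals_Archimedean2 by blast
  then have "\<phi> s < lo + real N * D" using D by (simp add: field_simps)
  ultimately show ?thesis using I by blast
qed

text \<open>The additional summand 1 pays for the last evaluation of the guard, the one that ends
  the loop.\<close>

lemma while_tm_potential:
  fixes \<phi> :: "'s \<Rightarrow> real"
  assumes "\<And>s. I s \<Longrightarrow> fst (b s) \<Longrightarrow> I (fst (f s))"
    and "\<And>s. I s \<Longrightarrow> fst (b s) \<Longrightarrow> \<phi> (fst (f s)) + D \<le> \<phi> s"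
    and "\<And>s. I s \<Longrightarrow> lo \<le> \<phi> s" "0 < D"
    and cost: "\<And>s. I s \<Longrightarrow> real (snd (b s) + snd (f s)) \<le> K"
    and "I s"
  shows "\<exists>s' t. while_tm b f s = Some (s', t) \<and> I s' \<and> \<not> fst (b s') \<and>
    real t \<le> K * ((\<phi> s - lo) / D + 1)"
proof -
  obtain s' t where W: "while_option (\<lambda>(s, t). fst (b s))
      (\<lambda>(s, t). (fst (f s), t + snd (b s) + snd (f s))) (s, 0) = Some (s', t)"
    and s': "I s'" "\<not> fst (b s')" and t: "real t \<le> real 0 + K * ((\<phi> s - lo) / D)"
    using while_option_potential[where I = I and b = b and f = f and \<phi> = \<phi> and D = D and lo = lo
        and K = K and s = s and t = 0, OF assms] by blast
  show ?thesis
    unfolding while_tm_def W using s' t cost[OF s'(1)] by (simp add: distrib_left)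
qed

section \<open>Results and exact operation counts of the elementary routines\<close>

lemma row_sums_tm_eq: "row_sums_tm A = (row_sums A, dim_row A * dim_col A)"
  by (auto simp: row_sums_tm_def vec_tm_def sum_tm_def ret_def intro!: eq_vecI)

lemma col_sums_tm_eq: "col_sums_tm A = (col_sums A, dim_col A * dim_row A)"
  by (auto simp: col_sums_tm_def vec_tm_def sum_tm_def ret_def intro!: eq_vecI)

lemma sub_vec_tm_eq: "sub_vec_tm u v = (u - v, dim_vec v)"
  by (auto simp: sub_vec_tm_def vec_tm_def op_def minus_vec_def)

lemma l1_norm_tm_eq: "l1_norm_tm v = (l1_norm v, 2 * dim_vec v)"
  by (simp add: l1_norm_tm_def sum_tm_def op_def l1_norm_def)

lemma inaccurate_tm_eq:
  "inaccurate_tm r c \<delta> s t =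
    (\<delta> < ereal (l1_norm (s - r) + l1_norm (t - c)), 3 * dim_vec r + 3 * dim_vec c + 2)"
  by (simp add: inaccurate_tm_def bind_tm_def sub_vec_tm_eq l1_norm_tm_eq op_def)

lemma normalize_tm_eq:
  "normalize_tm A = ((1 / entry_l1_norm A) \<cdot>\<^sub>m A, 3 * (dim_row A * dim_col A) + dim_row A)"
  by (auto simp: normalize_tm_def bind_tm_def sum_tm_def mat_tm_def op_def entry_l1_norm_def
      distrib_left intro!: eq_matI)

lemma scaled_entry_tm_eq: "scaled_entry_tm u a v = (exp u * a * exp v, 4)"
  by (simp add: scaled_entry_tm_def bind_tm_def op_def)

lemma update_tm_eq: "update_tm u a b = (u + ln (a / b), 3)"
  by (simp add: update_tm_def bind_tm_def op_def)

lemma rho_tm_eq: "rho_tm a b = (rho a b, 5)"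
  by (simp add: rho_tm_def bind_tm_def op_def rho_def)

lemma argmax_tm_eq: "argmax_tm sel k v = (sel k v, dim_vec v)"
  by (simp add: argmax_tm_def)

lemmas tm_simps = bind_tm_def op_def ret_def vec_tm_def mat_tm_def sum_tm_def row_sums_tm_eq col_sums_tm_eq
  sub_vec_tm_eq l1_norm_tm_eq scaled_entry_tm_eq update_tm_eq rho_tm_eq argmax_tm_eq

lemma dim_exp_scale [simp]:
  "dim_row (exp_scale x A y) = dim_row A" "dim_col (exp_scale x A y) = dim_col A"
  by (simp_all add: exp_scale_def diag_scale_eq)

lemma index_exp_scale [simp]:
  "i < dim_row A \<Longrightarrow> j < dim_col A \<Longrightarrow> exp_scale x A y $$ (i, j) = exp (x $ i) * A $$ (i, j) * exp (y $ j)"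
  by (simp add: exp_scale_def diag_scale_eq)

section \<open>Convergence of the scaling algorithms\<close>

text \<open>
  The accuracy \<open>\<delta>\<close> may be infinite or large; \<open>d\<close> is a finite lower bound of it, at most one,
  in which the iteration count is expressed.
\<close>

locale scaling_problem =
  fixes n :: nat and A :: "real mat" and r c :: "real vec" and \<delta> :: ereal and d :: real
  assumes A: "pos_mat n A" and r: "pos_prob_vec n r" and c: "pos_prob_vec n c"
    and d: "0 < d" "d \<le> 1" "ereal d \<le> \<delta>"
begin

definition "A0 = (1 / entry_l1_norm A) \<cdot>\<^sub>m A"

abbreviation "pot x y \<equiv> potential n (\<lambda>i j. A0 $$ (i, j)) (\<lambda>i. r $ i) (\<lambda>j. c $ j) (\<lambda>i. x $ i) (\<lambda>j. y $ j)"

lemma dims [simp]: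
  "dim_row A = n" "dim_col A = n" "dim_row A0 = n" "dim_col A0 = n" "dim_vec r = n" "dim_vec c = n"
  using A r c by (auto simp: A0_def pos_mat_def pos_prob_vec_def)

lemma r_pos: "i < n \<Longrightarrow> 0 < r $ i" and c_pos: "i < n \<Longrightarrow> 0 < c $ i"
  and sum_r: "(\<Sum>i<n. r $ i) = 1" and sum_c: "(\<Sum>i<n. c $ i) = 1"
  using r c by (auto simp: pos_prob_vec_def)

lemma n_pos: "0 < n"
  using sum_r by (cases "n = 0") auto

lemma A_pos: "i < n \<Longrightarrow> j < n \<Longrightarrow> 0 < A $$ (i, j)"
  using A by (auto simp: pos_mat_def)

lemma norm_eq: "entry_l1_norm A = (\<Sum>i<n. \<Sum>j<n. A $$ (i, j))"
  using A_pos by (auto simp: entry_l1_norm_def less_imp_le intro!: sum.cong)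

lemma norm_pos: "0 < entry_l1_norm A"
  unfolding norm_eq using A_pos n_pos by (intro sum_pos) auto

lemma A0_pos: "i < n \<Longrightarrow> j < n \<Longrightarrow> 0 < A0 $$ (i, j)"
  using A_pos norm_pos by (simp add: A0_def)

lemma sum_A0: "(\<Sum>i<n. \<Sum>j<n. A0 $$ (i, j)) = 1"
proof -
  have "(\<Sum>i<n. \<Sum>j<n. A0 $$ (i, j)) = (\<Sum>i<n. \<Sum>j<n. A $$ (i, j) / entry_l1_norm A)"
    by (simp add: A0_def)
  also have "\<dots> = entry_l1_norm A / entry_l1_norm A"
    by (simp only: norm_eq sum_divide_distrib)
  finally show ?thesis using norm_pos by simp
qed

text \<open>The normalisation makes the starting value equal to the constant in the lower bound
  \<open>1 + ln l\<close>, so the whole budget of decrease is - ln l.\<close>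

lemma pot_zero: "pot (0\<^sub>v n) (0\<^sub>v n) = 1"
  using sum_A0 by (simp add: potential_def)

lemma pot_ge:
  assumes "0 < l" "\<And>i j. i < n \<Longrightarrow> j < n \<Longrightarrow> l \<le> A0 $$ (i, j)"
  shows "1 + ln l \<le> pot x y"
  using assms r_pos c_pos sum_r sum_c by (intro potential_ge) auto

lemma ln_lower_le_0:
  assumes "0 < l" "\<And>i j. i < n \<Longrightarrow> j < n \<Longrightarrow> l \<le> A0 $$ (i, j)"
  shows "ln l \<le> 0"
  using pot_ge[OF assms, of "0\<^sub>v n" "0\<^sub>v n"] pot_zero by simp

lemma row_sum_scaled:
  "i < n \<Longrightarrow> row_sums (exp_scale x A0 y) $ i = (\<Sum>j<n. A0 $$ (i, j) * exp (x $ i + y $ j))"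
  by (auto simp: exp_add intro!: sum.cong)

lemma col_sum_scaled:
  "j < n \<Longrightarrow> col_sums (exp_scale x A0 y) $ j = (\<Sum>i<n. A0 $$ (i, j) * exp (y $ j + x $ i))"
  by (auto simp: exp_add intro!: sum.cong)

lemma row_sum_pos: "i < n \<Longrightarrow> 0 < row_sums (exp_scale x A0 y) $ i"
  unfolding row_sum_scaled using n_pos A0_pos by (intro sum_pos) auto

lemma col_sum_pos: "j < n \<Longrightarrow> 0 < col_sums (exp_scale x A0 y) $ j"
  unfolding col_sum_scaled using n_pos A0_pos by (intro sum_pos) auto

lemma pot_row_update:
  assumes "\<And>i. i < n \<Longrightarrow> x' $ i =
      (if i \<in> I then x $ i + ln (r $ i / row_sums (exp_scale x A0 y) $ i) else x $ i)"
    and "I \<subseteq> {..<n}"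
  shows "pot x' y = pot x y - (\<Sum>i\<in>I. rho (r $ i) (row_sums (exp_scale x A0 y) $ i))"
  using assms A0_pos r_pos n_pos row_sum_scaled by (intro potential_row_update) auto

lemma pot_col_update:
  assumes "\<And>j. j < n \<Longrightarrow> y' $ j =
      (if j \<in> J then y $ j + ln (c $ j / col_sums (exp_scale x A0 y) $ j) else y $ j)"
    and "J \<subseteq> {..<n}"
  shows "pot x y' = pot x y - (\<Sum>j\<in>J. rho (c $ j) (col_sums (exp_scale x A0 y) $ j))"
  unfolding potential_transpose[of n "\<lambda>i j. A0 $$ (i, j)"]
  using assms A0_pos c_pos n_pos col_sum_scaled by (intro potential_row_update) auto

lemma row_sums_full_update:
  assumes "x' = vec n (\<lambda>i. x $ i + ln (r $ i / row_sums (exp_scale x A0 y) $ i))"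
  shows "row_sums (exp_scale x' A0 y) = r"
proof (rule eq_vecI)
  fix i assume "i < dim_vec r"
  then have i: "i < n" by simp
  define s where "s = row_sums (exp_scale x A0 y) $ i"
  have "row_sums (exp_scale x' A0 y) $ i = exp (ln (r $ i / s)) * s"
    unfolding s_def row_sum_scaled[OF i] sum_distrib_left
    using i by (intro sum.cong) (simp_all add: assms exp_add row_sum_scaled[OF i] del: row_sums_index)
  also have "\<dots> = r $ i" using row_sum_pos[OF i, of x y] r_pos[OF i] unfolding s_def by simp
  finally show "row_sums (exp_scale x' A0 y) $ i = r $ i" .
qed simp

lemma col_sums_full_update:
  assumes "y' = vec n (\<lambda>j. y $ j + ln (c $ j / col_sums (exp_scale x A0 y) $ j))"
  shows "col_sums (exp_scale x A0 y') = c"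
proof (rule eq_vecI)
  fix j assume "j < dim_vec c"
  then have j: "j < n" by simp
  define t where "t = col_sums (exp_scale x A0 y) $ j"
  have "col_sums (exp_scale x A0 y') $ j = exp (ln (c $ j / t)) * t"
    unfolding t_def col_sum_scaled[OF j] sum_distrib_left
    using j by (intro sum.cong) (simp_all add: assms exp_add col_sum_scaled[OF j] del: col_sums_index)
  also have "\<dots> = c $ j" using col_sum_pos[OF j, of x y] c_pos[OF j] unfolding t_def by simp
  finally show "col_sums (exp_scale x A0 y') $ j = c $ j" .
qed simp

lemma row_rho_ge:
  assumes "d / 2 \<le> l1_norm (row_sums (exp_scale x A0 y) - r)"
  shows "d\<^sup>2 / 20 \<le> (\<Sum>i<n. rho (r $ i) (row_sums (exp_scale x A0 y) $ i))"
  using assms d r_pos sum_r row_sum_pos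
  by (intro sum_rho_ge) (auto simp: l1_norm_def simp del: row_sums_index)

lemma col_rho_ge:
  assumes "d / 2 \<le> l1_norm (col_sums (exp_scale x A0 y) - c)"
  shows "d\<^sup>2 / 20 \<le> (\<Sum>j<n. rho (c $ j) (col_sums (exp_scale x A0 y) $ j))"
  using assms d c_pos sum_c col_sum_pos
  by (intro sum_rho_ge) (auto simp: l1_norm_def simp del: col_sums_index)

text \<open>A projection must return a scaling of \<open>A\<close>, while the algorithms scale
  \<open>A0\<close>; the normalising constant is absorbed into the left factor.\<close>

lemma exp_scale_diag_scale:
  "\<exists>u v. (\<forall>i<n. 0 < u i) \<and> (\<forall>j<n. 0 < v j) \<and> exp_scale x A0 y = diag_scale u A v"
  using norm_pos
  by (intro exI[of _ "\<lambda>i. exp (x $ i) / entry_l1_norm A"] exI[of _ "\<lambda>j. exp (y $ j)"])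
     (auto simp: exp_scale_def diag_scale_eq A0_def intro!: eq_matI)

end

text \<open>The reason why Greenkhorn can repair a stored sum with one difference when a single
  entry changes.\<close>

lemma sum_replace:
  fixes f :: "nat \<Rightarrow> real" and n :: nat
  assumes "I < n"
  shows "(\<Sum>i<n. if i = I then a else f i) = (\<Sum>i<n. f i) + (a - f I)"
proof -
  have "(\<Sum>i<n. if i = I then a else f i) = (\<Sum>i<n. f i + (if i = I then a - f I else 0))"
    by (intro sum.cong) auto
  also have "\<dots> = (\<Sum>i<n. f i) + (a - f I)"
    using assms by (simp add: sum.distrib)
  finally show ?thesis .
qed

context scaling_problem
begin

lemma normalize_eq: "normalize_tm A = (A0, 3 * (n * n) + n)"
  by (simp add: normalize_tm_eq flip: A0_def)

lemma exp_scale_zero: "exp_scale (0\<^sub>v n) A0 (0\<^sub>v n) = A0"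
  by (auto intro!: eq_matI)

lemma inaccurate_gap:
  assumes "\<delta> < ereal e"
  shows "d \<le> e"
  using assms d(3) by (metis ereal_less_eq(3) less_imp_le order_trans)

subsection \<open>Sinkhorn\<close>

text \<open>The step without its cost. Parity is that of the old counter here, whereas the algorithm
  tests the incremented one: \<open>even k\<close> selects a row update.\<close>

definition sinkhorn_next :: "nat \<times> real mat \<times> real vec \<times> real vec \<Rightarrow> nat \<times> real mat \<times> real vec \<times> real vec"
  where "sinkhorn_next = (\<lambda>(k, B, x, y).
    let x' = (if even k then vec n (\<lambda>i. x $ i + ln (r $ i / row_sums B $ i)) else x);
        y' = (if even k then y else vec n (\<lambda>j. y $ j + ln (c $ j / col_sums B $ j)))
    in (k + 1, exp_scale x' A0 y', x', y'))"

lemma sinkhorn_step_eq: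
  assumes "dim_row B = n" "dim_col B = n"
  shows "sinkhorn_step A0 r c (k, B, x, y) = (sinkhorn_next (k, B, x, y), 5 * (n * n) + 3 * n + 2)"
  using assms
  by (auto simp: sinkhorn_step_def sinkhorn_next_def tm_simps Let_def simp del: row_sums_index col_sums_index
      intro!: eq_matI)

text \<open>After each step one marginal is exact, so that the entire error sits in the marginal
  updated next. Nothing of the kind holds for the initial matrix, hence the exception at k =
  0.\<close>

definition sinkhorn_inv :: "nat \<times> real mat \<times> real vec \<times> real vec \<Rightarrow> bool" where
  "sinkhorn_inv = (\<lambda>(k, B, x, y). x \<in> carrier_vec n \<and> y \<in> carrier_vec n \<and> B = exp_scale x A0 y \<and>
    (0 < k \<longrightarrow> (if even k then col_sums B = c else row_sums B = r)))"

lemma sinkhorn_next_inv: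
  assumes "sinkhorn_inv s"
  shows "sinkhorn_inv (sinkhorn_next s)"
  using assms row_sums_full_update col_sums_full_update
  by (auto simp: sinkhorn_inv_def sinkhorn_next_def Let_def split: prod.splits)

text \<open>The first step decreases the potential by an amount that need not be controlled; the extra
  summand at \<open>k = 0\<close> makes up for this.\<close>

definition sinkhorn_pot :: "nat \<times> real mat \<times> real vec \<times> real vec \<Rightarrow> real" where
  "sinkhorn_pot = (\<lambda>(k, B, x, y). pot x y + (if k = 0 then d\<^sup>2 / 20 else 0))"

lemma sinkhorn_next_pot:
  assumes inv: "sinkhorn_inv (k, B, x, y)"
    and gap: "\<delta> < ereal (l1_norm (row_sums B - r) + l1_norm (col_sums B - c))"
  shows "sinkhorn_pot (sinkhorn_next (k, B, x, y)) + d\<^sup>2 / 20 \<le> sinkhorn_pot (k, B, x, y)"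
proof -
  have B: "B = exp_scale x A0 y" using inv by (simp add: sinkhorn_inv_def)
  have err: "d \<le> l1_norm (row_sums B - r) + l1_norm (col_sums B - c)"
    using gap by (rule inaccurate_gap)
  have zero: "l1_norm (v - v) = 0" for v :: "real vec" by (simp add: l1_norm_def)
  show ?thesis
  proof (cases "even k")
    case True
    define x' where "x' = vec n (\<lambda>i. x $ i + ln (r $ i / row_sums B $ i))"
    have next_eq: "sinkhorn_next (k, B, x, y) = (k + 1, exp_scale x' A0 y, x', y)"
      using True by (simp add: sinkhorn_next_def x'_def Let_def)
    have dec: "pot x' y = pot x y - (\<Sum>i<n. rho (r $ i) (row_sums B $ i))"
      unfolding B by (rule pot_row_update) (simp_all add: x'_def B del: row_sums_index)
    show ?thesis
    proof (cases "k = 0")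
      case True
      have "0 \<le> (\<Sum>i<n. rho (r $ i) (row_sums B $ i))"
        unfolding B using r_pos row_sum_pos by (intro sum_nonneg rho_nonneg) auto
      then show ?thesis unfolding next_eq using True dec by (simp add: sinkhorn_pot_def)
    next
      case False
      then have "col_sums B = c" using inv \<open>even k\<close> by (auto simp: sinkhorn_inv_def)
      then have "d / 2 \<le> l1_norm (row_sums B - r)" using err zero d by simp
      then have "d\<^sup>2 / 20 \<le> (\<Sum>i<n. rho (r $ i) (row_sums B $ i))"
        unfolding B by (rule row_rho_ge)
      then show ?thesis using False dec by (simp add: next_eq sinkhorn_pot_def)
    qed
  next
    case False
    define y' where "y' = vec n (\<lambda>j. y $ j + ln (c $ j / col_sums B $ j))"
    have next_eq: "sinkhorn_next (k, B, x, y) = (k + 1, exp_scale x A0 y', x, y')"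
      using False by (simp add: sinkhorn_next_def y'_def Let_def)
    have dec: "pot x y' = pot x y - (\<Sum>j<n. rho (c $ j) (col_sums B $ j))"
      unfolding B by (rule pot_col_update) (simp_all add: y'_def B del: col_sums_index)
    have k: "0 < k" using False by (cases k) auto
    then have "row_sums B = r" using inv False by (auto simp: sinkhorn_inv_def)
    then have "d / 2 \<le> l1_norm (col_sums B - c)" using err zero d by simp
    then have "d\<^sup>2 / 20 \<le> (\<Sum>j<n. rho (c $ j) (col_sums B $ j))"
      unfolding B by (rule col_rho_ge)
    then show ?thesis using k dec by (simp add: next_eq sinkhorn_pot_def)
  qed
qed

text \<open>The constant 700 is chosen to cover Greenkhorn too. Here the count is 40 + 400 (- ln l /
  d^2) in units of n^2, plus at most 4 for the normalisation.\<close>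

lemma sinkhorn_terminates:
  assumes l: "0 < l" "\<And>i j. i < n \<Longrightarrow> j < n \<Longrightarrow> l \<le> A0 $$ (i, j)"
  shows "\<exists>x y S. sinkhorn A r c \<delta> = Some (exp_scale x A0 y, S) \<and>
    ereal (marginal_error (exp_scale x A0 y) r c) \<le> \<delta> \<and>
    real S \<le> 700 * real n ^ 2 * (1 + - ln l / d\<^sup>2)"
proof -
  let ?b = "\<lambda>(k :: nat, B, x :: real vec, y :: real vec).
    bind_tm (row_sums_tm B) (\<lambda>s. bind_tm (col_sums_tm B) (\<lambda>t. inaccurate_tm r c \<delta> s t))"
  let ?s0 = "(0 :: nat, A0, 0\<^sub>v n :: real vec, 0\<^sub>v n :: real vec)"
  have guard: "?b (k, B, x, y) =
      (\<delta> < ereal (l1_norm (row_sums B - r) + l1_norm (col_sums B - c)), 2 * (n * n) + 6 * n + 2)"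
    if "sinkhorn_inv (k, B, x, y)" for k B x y
    using that by (auto simp: sinkhorn_inv_def bind_tm_def row_sums_tm_eq col_sums_tm_eq inaccurate_tm_eq)
  have step: "sinkhorn_step A0 r c (k, B, x, y) = (sinkhorn_next (k, B, x, y), 5 * (n * n) + 3 * n + 2)"
    if "sinkhorn_inv (k, B, x, y)" for k B x y
    using that by (intro sinkhorn_step_eq) (auto simp: sinkhorn_inv_def)
  have n2: "real n \<le> real n * real n" "1 \<le> real n * real n"
    using n_pos by (auto simp: mult_ge1_I)
  have "\<exists>s t. while_tm ?b (sinkhorn_step A0 r c) ?s0 = Some (s, t) \<and> sinkhorn_inv s \<and> \<not> fst (?b s) \<and>
      real t \<le> 20 * real n ^ 2 * ((sinkhorn_pot ?s0 - (1 + ln l)) / (d\<^sup>2 / 20) + 1)"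
  proof (rule while_tm_potential)
    show "sinkhorn_inv (fst (sinkhorn_step A0 r c s))" if "sinkhorn_inv s" for s
      using that step sinkhorn_next_inv by (cases s) auto
    show "sinkhorn_pot (fst (sinkhorn_step A0 r c s)) + d\<^sup>2 / 20 \<le> sinkhorn_pot s"
      if "sinkhorn_inv s" "fst (?b s)" for s
    proof -
      obtain k B x y where s: "s = (k, B, x, y)" by (cases s)
      show ?thesis
        using that unfolding s step[OF that(1)[unfolded s]] fst_conv
        by (intro sinkhorn_next_pot) (simp_all only: guard fst_conv)
    qed
    show "1 + ln l \<le> sinkhorn_pot s" if "sinkhorn_inv s" for s
      using pot_ge[OF l] by (auto simp: sinkhorn_pot_def intro: add_increasing2 split: prod.splits)
    show "0 < d\<^sup>2 / 20" using d by simp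
    show "real (snd (?b s) + snd (sinkhorn_step A0 r c s)) \<le> 20 * real n ^ 2" if "sinkhorn_inv s" for s
    proof -
      obtain k B x y where s: "s = (k, B, x, y)" by (cases s)
      have "real (snd (?b s) + snd (sinkhorn_step A0 r c s)) = 7 * (real n * real n) + 9 * real n + 4"
        using that unfolding s by (simp only: guard step snd_conv) simp
      \<comment> \<open>Test and step together take 7 n^2 + 9 n + 4 operations, at most 20
        n^2.\<close>
      then show ?thesis using n2 unfolding power2_eq_square by linarith
    qed
    show "sinkhorn_inv ?s0" by (simp add: sinkhorn_inv_def exp_scale_zero)
  qed
  then obtain s t where W: "while_tm ?b (sinkhorn_step A0 r c) ?s0 = Some (s, t)"
    and inv: "sinkhorn_inv s" and stop: "\<not> fst (?b s)"
    and t: "real t \<le> 20 * real n ^ 2 * ((sinkhorn_pot ?s0 - (1 + ln l)) / (d\<^sup>2 / 20) + 1)"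
    by (elim exE conjE)
  obtain k B x y where s: "s = (k, B, x, y)" by (cases s)
  note W = W[unfolded s] and inv = inv[unfolded s] and stop = stop[unfolded s]
  have B: "B = exp_scale x A0 y" using inv by (simp add: sinkhorn_inv_def)
  have "sinkhorn A r c \<delta> = Some (B, 3 * (n * n) + n + t)"
    unfolding sinkhorn_def normalize_eq dims prod.case W by simp
  moreover have "ereal (marginal_error B r c) \<le> \<delta>"
    using stop unfolding guard[OF inv] by (simp add: marginal_error_def not_less)
  moreover have "real (3 * (n * n) + n + t) \<le> 700 * real n ^ 2 * (1 + - ln l / d\<^sup>2)"
  proof -
    \<comment> \<open>The leading 1 is the credit granted at k = 0 for the uncontrolled first
      step.\<close>
    have e: "(sinkhorn_pot ?s0 - (1 + ln l)) / (d\<^sup>2 / 20) = 1 + 20 * (- ln l / d\<^sup>2)"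
      using d pot_zero by (simp add: sinkhorn_pot_def field_simps)
    have "real t \<le> 40 * real n ^ 2 + 400 * (real n ^ 2 * (- ln l / d\<^sup>2))"
      using t unfolding e by (simp add: algebra_simps)
    moreover have "0 \<le> real n ^ 2 * (- ln l / d\<^sup>2)"
      using ln_lower_le_0[OF l] by (intro mult_nonneg_nonneg divide_nonneg_nonneg) auto
    moreover have "real (3 * (n * n) + n + t) \<le> 4 * real n ^ 2 + real t"
      using n2 by (simp add: power2_eq_square)
    ultimately have "real (3 * (n * n) + n + t) \<le> 700 * real n ^ 2 + 700 * (real n ^ 2 * (- ln l / d\<^sup>2))"
      using zero_le_power2[of "real n"] by argo
    then show ?thesis by (simp add: algebra_simps)
  qed
  ultimately show ?thesis unfolding B by blast
qed

subsection \<open>Greenkhorn\<close>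

context
  fixes selr selc :: "nat \<Rightarrow> real vec \<Rightarrow> nat"
  assumes selr: "argmax_selector selr" and selc: "argmax_selector selc"
begin

definition greenkhorn_next :: "nat \<times> real mat \<times> real vec \<times> real vec \<Rightarrow> nat \<times> real mat \<times> real vec \<times> real vec"
  where "greenkhorn_next = (\<lambda>(k, B, x, y).
    let s = row_sums B; t = col_sums B;
        p = vec n (\<lambda>i. rho (r $ i) (s $ i));
        q = vec n (\<lambda>j. rho (c $ j) (t $ j));
        I = selr k p; J = selc k q;
        (x', y') = (if p $ I > q $ J
                    then (x |\<^sub>v I \<mapsto> x $ I + ln (r $ I / s $ I), y)
                    else (x, y |\<^sub>v J \<mapsto> y $ J + ln (c $ J / t $ J)))
    in (k + 1, exp_scale x' A0 y', x', y'))"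

definition greenkhorn_inv :: "nat \<times> real mat \<times> real vec \<times> real vec \<Rightarrow> bool" where
  "greenkhorn_inv = (\<lambda>(k, B, x, y). x \<in> carrier_vec n \<and> y \<in> carrier_vec n \<and> B = exp_scale x A0 y)"

text \<open>The refinement relation in functional form: the reachable states of the implementation
  are exactly of this shape, that is, their stored sums are up to date.\<close>

definition with_sums :: "nat \<times> real mat \<times> real vec \<times> real vec \<Rightarrow> greenkhorn_state" where
  "with_sums = (\<lambda>(k, B, x, y). (k, B, row_sums B, col_sums B, x, y))"

lemma selr_max: "selr k (vec n p) < n" "i < n \<Longrightarrow> p i \<le> p (selr k (vec n p))"
  and selc_max: "selc k (vec n p) < n" "i < n \<Longrightarrow> p i \<le> p (selc k (vec n p))"
proof -
  have "is_arg_max (\<lambda>i. vec n p $ i) (\<lambda>i. i < n) (selr k (vec n p))"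
    "is_arg_max (\<lambda>i. vec n p $ i) (\<lambda>i. i < n) (selc k (vec n p))"
    using selr selc n_pos unfolding argmax_selector_def by (metis dim_vec)+
  then show "selr k (vec n p) < n" "i < n \<Longrightarrow> p i \<le> p (selr k (vec n p))"
    "selc k (vec n p) < n" "i < n \<Longrightarrow> p i \<le> p (selc k (vec n p))"
    by (auto simp: is_arg_max_linorder)
qed

lemma greenkhorn_next_inv: "greenkhorn_inv s \<Longrightarrow> greenkhorn_inv (greenkhorn_next s)"
  by (auto simp: greenkhorn_inv_def greenkhorn_next_def Let_def update_vec_def split: prod.splits if_splits)

lemma greenkhorn_next_pot:
  assumes inv: "greenkhorn_inv (k, B, x, y)"
    and gap: "\<delta> < ereal (l1_norm (row_sums B - r) + l1_norm (col_sums B - c))"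
    and step: "greenkhorn_next (k, B, x, y) = (k', B', x', y')"
  shows "pot x' y' + d\<^sup>2 / (20 * n) \<le> pot x y"
proof -
  have B: "B = exp_scale x A0 y" using inv by (simp add: greenkhorn_inv_def)
  have xy: "dim_vec x = n" "dim_vec y = n" using inv by (auto simp: greenkhorn_inv_def)
  define f where "f = (\<lambda>i. rho (r $ i) (row_sums B $ i))"
  define g where "g = (\<lambda>j. rho (c $ j) (col_sums B $ j))"
  define I where "I = selr k (vec n f)"
  define J where "J = selc k (vec n g)"
  have IJ: "I < n" "J < n" unfolding I_def J_def using selr_max selc_max by auto
  have fI: "(\<Sum>i<n. f i) \<le> n * f I" and gJ: "(\<Sum>j<n. g j) \<le> n * g J"
    using selr_max(2) selc_max(2) sum_bounded_above[of "{..<n}" f "f I"] sum_bounded_above[of "{..<n}" g "g J"]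
    unfolding I_def J_def by auto
  have next_eq: "(x', y') = (if f I > g J
      then (x |\<^sub>v I \<mapsto> x $ I + ln (r $ I / row_sums B $ I), y)
      else (x, y |\<^sub>v J \<mapsto> y $ J + ln (c $ J / col_sums B $ J)))"
    using step IJ unfolding greenkhorn_next_def Let_def
    by (auto simp flip: f_def g_def I_def J_def simp del: row_sums_index col_sums_index split: if_splits)
  have "d / 2 \<le> l1_norm (row_sums B - r) \<or> d / 2 \<le> l1_norm (col_sums B - c)"
    using inaccurate_gap[OF gap] by linarith
  \<comment> \<open>A sum of n terms is at most n times its largest term. As the update realises the
    larger of the two maxima, it does not matter which marginal carries the error.\<close>
  then have "d\<^sup>2 / 20 \<le> n * max (f I) (g J)"
  proof
    assume "d / 2 \<le> l1_norm (row_sums B - r)"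
    then have "d\<^sup>2 / 20 \<le> (\<Sum>i<n. f i)" unfolding B f_def by (rule row_rho_ge)
    also note fI
    also have "n * f I \<le> n * max (f I) (g J)" by (intro mult_left_mono) auto
    finally show ?thesis .
  next
    assume "d / 2 \<le> l1_norm (col_sums B - c)"
    then have "d\<^sup>2 / 20 \<le> (\<Sum>j<n. g j)" unfolding B g_def by (rule col_rho_ge)
    also note gJ
    also have "n * g J \<le> n * max (f I) (g J)" by (intro mult_left_mono) auto
    finally show ?thesis .
  qed
  then have gain: "d\<^sup>2 / (20 * n) \<le> max (f I) (g J)" using n_pos by (simp add: field_simps)
  show ?thesis
  proof (cases "f I > g J")
    case True
    then have x': "x' = x |\<^sub>v I \<mapsto> x $ I + ln (r $ I / row_sums B $ I)" and y': "y' = y"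
      using next_eq by auto
    have "pot x' y = pot x y - (\<Sum>i\<in>{I}. f i)"
      unfolding B f_def using IJ xy
      by (intro pot_row_update) (auto simp: x' B update_vec_def simp del: row_sums_index)
    then show ?thesis using gain True y' by simp
  next
    case False
    then have y': "y' = y |\<^sub>v J \<mapsto> y $ J + ln (c $ J / col_sums B $ J)" and x': "x' = x"
      using next_eq by auto
    have "pot x y' = pot x y - (\<Sum>j\<in>{J}. g j)"
      unfolding B g_def using IJ xy
      by (intro pot_col_update) (auto simp: y' B update_vec_def simp del: col_sums_index)
    then show ?thesis using gain False x' by simp
  qed
qed

section \<open>Incremental maintenance of the matrix and its marginals in Greenkhorn\<close>

lemma set_row_exp_scale:
  assumes "x \<in> carrier_vec n" "I < n"
  shows "set_row (exp_scale x A0 y) I (vec n (\<lambda>j. exp u * A0 $$ (I, j) * exp (y $ j))) =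
    exp_scale (x |\<^sub>v I \<mapsto> u) A0 y"
  using assms by (auto simp: set_row_def update_vec_def intro!: eq_matI)

lemma set_col_exp_scale:
  assumes "y \<in> carrier_vec n" "J < n"
  shows "set_col (exp_scale x A0 y) J (vec n (\<lambda>i. exp (x $ i) * A0 $$ (i, J) * exp u)) =
    exp_scale x A0 (y |\<^sub>v J \<mapsto> u)"
  using assms by (auto simp: set_col_def update_vec_def intro!: eq_matI)

lemma row_sums_set_row:
  assumes "dim_row B = n" "dim_col B = n" "dim_vec w = n"
  shows "row_sums (set_row B I w) = row_sums B |\<^sub>v I \<mapsto> (\<Sum>j<n. w $ j)"
  using assms by (auto simp: set_row_def update_vec_def intro!: eq_vecI)

lemma col_sums_set_col:
  assumes "dim_row B = n" "dim_col B = n" "dim_vec w = n"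
  shows "col_sums (set_col B J w) = col_sums B |\<^sub>v J \<mapsto> (\<Sum>i<n. w $ i)"
  using assms by (auto simp: set_col_def update_vec_def intro!: eq_vecI)

lemma col_sums_set_row:
  assumes "dim_row B = n" "dim_col B = n" "dim_vec w = n" "I < n"
  shows "col_sums (set_row B I w) = vec n (\<lambda>j. col_sums B $ j + (w $ j - row B I $ j))"
  using assms by (auto simp: set_row_def sum_replace intro!: eq_vecI)

lemma row_sums_set_col:
  assumes "dim_row B = n" "dim_col B = n" "dim_vec w = n" "J < n"
  shows "row_sums (set_col B J w) = vec n (\<lambda>i. row_sums B $ i + (w $ i - col B J $ i))"
  using assms by (auto simp: set_col_def sum_replace intro!: eq_vecI)

text \<open>The simulation on which both the correctness and the running time of Greenkhorn rest.
  Row and column branches cost the same, so the linear count is exact.\<close>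

lemma greenkhorn_step_eq:
  assumes inv: "greenkhorn_inv (k, B, x, y)"
  shows "greenkhorn_step selr selc A0 r c (with_sums (k, B, x, y)) =
    (with_sums (greenkhorn_next (k, B, x, y)), 19 * n + 5)"
proof -
  have B: "B = exp_scale x A0 y" and xy: "x \<in> carrier_vec n" "y \<in> carrier_vec n"
    using inv by (auto simp: greenkhorn_inv_def)
  define f where "f = (\<lambda>i. rho (r $ i) (row_sums B $ i))"
  define g where "g = (\<lambda>j. rho (c $ j) (col_sums B $ j))"
  define I where "I = selr k (vec n f)"
  define J where "J = selc k (vec n g)"
  have IJ: "I < n" "J < n" unfolding I_def J_def using selr_max selc_max by auto
  define u where "u = x $ I + ln (r $ I / row_sums B $ I)"
  define v where "v = y $ J + ln (c $ J / col_sums B $ J)"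
  have next_eq: "greenkhorn_next (k, B, x, y) = (if f I > g J
      then (k + 1, exp_scale (x |\<^sub>v I \<mapsto> u) A0 y, x |\<^sub>v I \<mapsto> u, y)
      else (k + 1, exp_scale x A0 (y |\<^sub>v J \<mapsto> v), x, y |\<^sub>v J \<mapsto> v))"
    using IJ unfolding greenkhorn_next_def Let_def
    by (simp flip: f_def g_def I_def J_def u_def v_def del: row_sums_index col_sums_index)
  define w where "w = vec n (\<lambda>j. exp u * A0 $$ (I, j) * exp (y $ j))"
  define z where "z = vec n (\<lambda>i. exp (x $ i) * A0 $$ (i, J) * exp v)"
  have dB: "dim_row B = n" "dim_col B = n" unfolding B by simp_all
  have ws: "(\<Sum>j<n. w $ j) = (\<Sum>j<n. exp u * A0 $$ (I, j) * exp (y $ j))"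
    and zs: "(\<Sum>i<n. z $ i) = (\<Sum>i<n. exp (x $ i) * A0 $$ (i, J) * exp v)"
    by (simp_all add: w_def z_def)
  have step: "greenkhorn_step selr selc A0 r c (with_sums (k, B, x, y)) =
    ((if f I > g J
      then (k + 1, set_row B I w, row_sums B |\<^sub>v I \<mapsto> (\<Sum>j<n. w $ j),
            vec n (\<lambda>j. col_sums B $ j + (w $ j - row B I $ j)), x |\<^sub>v I \<mapsto> u, y)
      else (k + 1, set_col B J z, vec n (\<lambda>i. row_sums B $ i + (z $ i - col B J $ i)),
            col_sums B |\<^sub>v J \<mapsto> (\<Sum>i<n. z $ i), x, y |\<^sub>v J \<mapsto> v)), 19 * n + 5)"
    using IJ dB unfolding greenkhorn_step_def with_sums_def
    by (simp add: tm_simps adjust_tm_def ws zs flip: f_def g_def I_def J_def u_def v_def w_def z_def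
        del: row_sums_index col_sums_index)
  have rw: "set_row B I w = exp_scale (x |\<^sub>v I \<mapsto> u) A0 y"
    unfolding B w_def using xy IJ by (intro set_row_exp_scale)
  have cz: "set_col B J z = exp_scale x A0 (y |\<^sub>v J \<mapsto> v)"
    unfolding B z_def using xy IJ by (intro set_col_exp_scale)
  have wz: "dim_vec w = n" "dim_vec z = n" by (simp_all add: w_def z_def)
  show ?thesis
    unfolding step next_eq
    by (simp add: with_sums_def row_sums_set_row[OF dB wz(1)] col_sums_set_row[OF dB wz(1) IJ(1)]
        col_sums_set_col[OF dB wz(2)] row_sums_set_col[OF dB wz(2) IJ(2)] del: row_sums_index col_sums_index
        flip: rw cz)
qed

lemma greenkhorn_start: "greenkhorn_inv (0, A0, 0\<^sub>v n, 0\<^sub>v n)"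
  by (simp add: greenkhorn_inv_def exp_scale_zero)

lemma greenkhorn_eq:
  "greenkhorn selr selc A r c \<delta> =
    map_option (\<lambda>((k, B, s, t, x, y), m). (B, 5 * (n * n) + n + m))
      (while_tm (\<lambda>(k, B, s, t, x, y). inaccurate_tm r c \<delta> s t)
        (greenkhorn_step selr selc A0 r c) (with_sums (0, A0, 0\<^sub>v n, 0\<^sub>v n)))"
  by (simp add: greenkhorn_def normalize_eq tm_simps with_sums_def case_prod_unfold)

lemma greenkhorn_terminates:
  assumes l: "0 < l" "\<And>i j. i < n \<Longrightarrow> j < n \<Longrightarrow> l \<le> A0 $$ (i, j)"
  shows "\<exists>x y S. greenkhorn selr selc A r c \<delta> = Some (exp_scale x A0 y, S) \<and>
    ereal (marginal_error (exp_scale x A0 y) r c) \<le> \<delta> \<and>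
    real S \<le> 700 * real n ^ 2 * (1 + - ln l / d\<^sup>2)"
proof -
  let ?b = "\<lambda>(k :: nat, B :: real mat, s, t, x :: real vec, y :: real vec). inaccurate_tm r c \<delta> s t"
  let ?f = "greenkhorn_step selr selc A0 r c"
  let ?s0 = "with_sums (0 :: nat, A0, 0\<^sub>v n, 0\<^sub>v n)"
  let ?inv = "\<lambda>s. \<exists>\<sigma>. s = with_sums \<sigma> \<and> greenkhorn_inv \<sigma>"
  let ?pot = "\<lambda>(k :: nat, B :: real mat, s, t, x :: real vec, y :: real vec). pot x y"
  have guard: "?b (with_sums (k, B, x, y)) =
      (\<delta> < ereal (l1_norm (row_sums B - r) + l1_norm (col_sums B - c)), 6 * n + 2)" for k B x y
    by (simp add: inaccurate_tm_eq with_sums_def)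
  have n1: "1 \<le> real n" using n_pos by simp
  have "\<exists>s t. while_tm ?b ?f ?s0 = Some (s, t) \<and> ?inv s \<and> \<not> fst (?b s) \<and>
      real t \<le> 32 * real n * ((?pot ?s0 - (1 + ln l)) / (d\<^sup>2 / (20 * n)) + 1)"
  proof (rule while_tm_potential[where I = ?inv and \<phi> = ?pot and b = ?b and f = ?f and s = ?s0])
    show "?inv (fst (?f s))" if I: "?inv s" for s
    proof -
      obtain k B x y where s: "s = with_sums (k, B, x, y)" and inv: "greenkhorn_inv (k, B, x, y)"
        using I by auto
      show ?thesis
        unfolding s greenkhorn_step_eq[OF inv] fst_conv using greenkhorn_next_inv[OF inv] by blast
    qed
    show "?pot (fst (?f s)) + d\<^sup>2 / (20 * n) \<le> ?pot s" if I: "?inv s" and gap: "fst (?b s)" for s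
    proof -
      obtain k B x y where s: "s = with_sums (k, B, x, y)" and inv: "greenkhorn_inv (k, B, x, y)"
        using I by auto
      obtain k' B' x' y' where nxt: "greenkhorn_next (k, B, x, y) = (k', B', x', y')"
        by (cases "greenkhorn_next (k, B, x, y)")
      show ?thesis
        using greenkhorn_next_pot[OF inv _ nxt] gap
        unfolding s guard greenkhorn_step_eq[OF inv] nxt by (simp add: with_sums_def)
    qed
    show "1 + ln l \<le> ?pot s" for s
      using pot_ge[OF l] by (simp split: prod.splits)
    show "0 < d\<^sup>2 / (20 * n)" using d n_pos by simp
    \<comment> \<open>The test takes 6 n + 2 operations and the step 19 n + 5, together at most 32
      n.\<close>
    show "real (snd (?b s) + snd (?f s)) \<le> 32 * real n" if I: "?inv s" for s
    proof -
      obtain k B x y where s: "s = with_sums (k, B, x, y)" and inv: "greenkhorn_inv (k, B, x, y)"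
        using I by auto
      show ?thesis using n1 unfolding s guard greenkhorn_step_eq[OF inv] by simp
    qed
    show "?inv ?s0" using greenkhorn_start by blast
  qed
  then obtain \<sigma> t where W: "while_tm ?b ?f ?s0 = Some (with_sums \<sigma>, t)"
    and inv: "greenkhorn_inv \<sigma>" and stop: "\<not> fst (?b (with_sums \<sigma>))"
    and t: "real t \<le> 32 * real n * ((?pot ?s0 - (1 + ln l)) / (d\<^sup>2 / (20 * n)) + 1)"
    by (elim exE conjE) simp
  obtain k B x y where \<sigma>: "\<sigma> = (k, B, x, y)" by (cases \<sigma>)
  note W = W[unfolded \<sigma>] and inv = inv[unfolded \<sigma>] and stop = stop[unfolded \<sigma>]
  have B: "B = exp_scale x A0 y" using inv by (simp add: greenkhorn_inv_def)
  have "greenkhorn selr selc A r c \<delta> = Some (B, 5 * (n * n) + n + t)"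
    unfolding greenkhorn_eq W by (simp add: with_sums_def)
  moreover have "ereal (marginal_error B r c) \<le> \<delta>"
    using stop unfolding guard by (simp add: marginal_error_def not_less)
  moreover have "real (5 * (n * n) + n + t) \<le> 700 * real n ^ 2 * (1 + - ln l / d\<^sup>2)"
  proof -
    have n2: "real n \<le> real n ^ 2" using n1 by (simp add: power2_eq_square)
    \<comment> \<open>The factor n lost in the guaranteed decrease reappears here; with the 32 n
      operations per step it gives 640 n^2.\<close>
    have e: "(?pot ?s0 - (1 + ln l)) / (d\<^sup>2 / (20 * n)) = 20 * real n * (- ln l / d\<^sup>2)"
      using d n_pos pot_zero by (simp add: with_sums_def field_simps)
    have "real t \<le> 32 * real n + 640 * (real n ^ 2 * (- ln l / d\<^sup>2))"
      using t unfolding e by (simp add: algebra_simps power2_eq_square)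
    moreover have "0 \<le> real n ^ 2 * (- ln l / d\<^sup>2)"
      using ln_lower_le_0[OF l] by (intro mult_nonneg_nonneg divide_nonneg_nonneg) auto
    moreover have "real (5 * (n * n) + n + t) = 5 * real n ^ 2 + real n + real t"
      by (simp add: power2_eq_square)
    ultimately have "real (5 * (n * n) + n + t) \<le> 700 * real n ^ 2 + 700 * (real n ^ 2 * (- ln l / d\<^sup>2))"
      using n2 zero_le_power2[of "real n"] by argo
    then show ?thesis by (simp add: algebra_simps)
  qed
  ultimately show ?thesis unfolding B by blast
qed

text \<open>Forgetting the stored sums and the clock maps one loop to the other. Guards and steps
  commute with this projection as long as the sums are up to date.\<close>

lemma greenkhorn_refines_spec:
  "map_option fst (greenkhorn selr selc A r c \<delta>) = greenkhorn_spec selr selc A r c \<delta>"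
proof -
  let ?b = "\<lambda>(k :: nat, B :: real mat, s, t, x :: real vec, y :: real vec). inaccurate_tm r c \<delta> s t"
  let ?f = "greenkhorn_step selr selc A0 r c"
  let ?s0 = "with_sums (0 :: nat, A0, 0\<^sub>v n, 0\<^sub>v n)"
  let ?drop = "\<lambda>((k :: nat, B :: real mat, s :: real vec, t :: real vec, x :: real vec, y :: real vec), m :: nat). (k, B, x, y)"
  let ?g = "\<lambda>(k :: nat, B, x :: real vec, y :: real vec). \<delta> < ereal (marginal_error B r c)"
  have "map_option ?drop (while_option (\<lambda>(s, t). fst (?b s))
      (\<lambda>(s, t). (fst (?f s), t + snd (?b s) + snd (?f s))) (?s0, 0)) =
    while_option ?g greenkhorn_next (?drop (?s0, 0))"
  proof (rule while_option_commute_invariant[where P = "\<lambda>(s, m). \<exists>\<sigma>. s = with_sums \<sigma> \<and> greenkhorn_inv \<sigma>"],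
      goal_cases)
    case (1 s)
    then obtain k B x y m where s: "s = (with_sums (k, B, x, y), m)" and inv: "greenkhorn_inv (k, B, x, y)"
      by (cases s) auto
    show ?case
      unfolding s prod.case greenkhorn_step_eq[OF inv] fst_conv using greenkhorn_next_inv[OF inv] by blast
  next
    case (2 s)
    then show ?case
      by (auto simp: with_sums_def inaccurate_tm_eq marginal_error_def)
  next
    case (3 s)
    then obtain k B x y m where s: "s = (with_sums (k, B, x, y), m)" and inv: "greenkhorn_inv (k, B, x, y)"
      by (cases s) auto
    show ?case
      unfolding s prod.case greenkhorn_step_eq[OF inv] fst_conv by (simp add: with_sums_def split: prod.splits)
  next
    case 4
    then show ?case using greenkhorn_start by blast
  qed
  then have "map_option (\<lambda>(k, B, x, y). B) (map_option ?drop (while_option (\<lambda>(s, t). fst (?b s))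
      (\<lambda>(s, t). (fst (?f s), t + snd (?b s) + snd (?f s))) (?s0, 0))) = greenkhorn_spec selr selc A r c \<delta>"
    unfolding greenkhorn_spec_def Let_def greenkhorn_next_def dims A0_def[symmetric] by (simp add: with_sums_def)
  then show ?thesis
    unfolding greenkhorn_eq while_tm_def
    by (simp add: option.map_comp o_def case_prod_unfold)
qed

end

end

section \<open>The approximation guarantee\<close>

text \<open>Needed for targets of any common mass, since an optimal plan is to be rounded to the
  marginals of a projected matrix. The rounding does not depend on the cost, so \<open>C\<close> and
  \<open>L\<close> stay quantified in the last conclusion.\<close>

lemma rounding_exists:
  fixes F :: "nat \<Rightarrow> nat \<Rightarrow> real" and r c :: "nat \<Rightarrow> real"
  assumes "\<And>i j. i < n \<Longrightarrow> j < n \<Longrightarrow> 0 \<le> F i j"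
    and "\<And>i. i < n \<Longrightarrow> 0 \<le> r i" "\<And>j. j < n \<Longrightarrow> 0 \<le> c j"
    and "(\<Sum>i<n. r i) = (\<Sum>j<n. c j)"
  obtains G where "\<And>i j. i < n \<Longrightarrow> j < n \<Longrightarrow> 0 \<le> G i j"
    "\<And>i. i < n \<Longrightarrow> (\<Sum>j<n. G i j) = r i" "\<And>j. j < n \<Longrightarrow> (\<Sum>i<n. G i j) = c j"
    "\<And>C L. 0 \<le> L \<Longrightarrow> (\<And>i j. i < n \<Longrightarrow> j < n \<Longrightarrow> 0 \<le> C i j \<and> C i j \<le> L) \<Longrightarrow>
      (\<Sum>i<n. \<Sum>j<n. (G i j - F i j) * C i j) \<le>
      L * ((\<Sum>i<n. \<bar>(\<Sum>j<n. F i j) - r i\<bar>) + (\<Sum>j<n. \<bar>(\<Sum>i<n. F i j) - c j\<bar>)) / 2"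
proof -
  define x where "x = (\<lambda>i. min (r i / (\<Sum>j<n. F i j)) 1)"
  define F1 where "F1 = (\<lambda>i j. x i * F i j)"
  define y where "y = (\<lambda>j. min (c j / (\<Sum>i<n. F1 i j)) 1)"
  define F2 where "F2 = (\<lambda>i j. F1 i j * y j)"
  define er where "er = (\<lambda>i. r i - (\<Sum>j<n. F2 i j))"
  define ec where "ec = (\<lambda>j. c j - (\<Sum>i<n. F2 i j))"
  define G where "G = (\<lambda>i j. F2 i j + er i * ec j / (\<Sum>i<n. \<bar>er i\<bar>))"
  note R = rounding_correct[of n F r c x F1 y F2 er ec G, OF assms
      fun_cong[OF x_def] fun_cong[OF fun_cong[OF F1_def]] fun_cong[OF y_def] fun_cong[OF fun_cong[OF F2_def]]
      fun_cong[OF er_def] fun_cong[OF ec_def] fun_cong[OF fun_cong[OF G_def]]]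
  show thesis by (rule that[of G]) (use R in blast)+
qed

lemma round_tm_correct:
  assumes F: "F \<in> carrier_mat n n" "\<And>i j. i < n \<Longrightarrow> j < n \<Longrightarrow> 0 \<le> F $$ (i, j)"
    and r: "pos_prob_vec n r" and c: "pos_prob_vec n c"
    and L: "0 \<le> L" "\<And>i j. i < n \<Longrightarrow> j < n \<Longrightarrow> 0 \<le> C i j \<and> C i j \<le> L"
  shows "\<exists>P. round_tm F r c = (P, 9 * (n * n) + 8 * n) \<and> P \<in> transport_polytope n r c \<and>
    (\<Sum>i<n. \<Sum>j<n. (P $$ (i, j) - F $$ (i, j)) * C i j) \<le> L * marginal_error F r c / 2"
proof -
  have rc: "r \<in> carrier_vec n" "c \<in> carrier_vec n" using r c by (auto simp: pos_prob_vec_def)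
  have dims: "dim_row F = n" "dim_col F = n" "dim_vec r = n" "dim_vec c = n" using F rc by auto
  define x where "x = (\<lambda>i. min (r $ i / row_sums F $ i) 1)"
  define F1 where "F1 = mat n n (\<lambda>(i, j). x i * F $$ (i, j))"
  define y where "y = (\<lambda>j. min (c $ j / col_sums F1 $ j) 1)"
  define F2 where "F2 = mat n n (\<lambda>(i, j). F1 $$ (i, j) * y j)"
  define er where "er = r - row_sums F2"
  define ec where "ec = c - col_sums F2"
  define P where "P = mat n n (\<lambda>(i, j). F2 $$ (i, j) + er $ i * ec $ j / l1_norm er)"
  have F1_tm: "mat n n (\<lambda>(i, j). vec n x $ i * F $$ (i, j)) = F1"
    unfolding F1_def by (auto intro!: eq_matI)
  have F2_tm: "mat n n (\<lambda>(i, j). F1 $$ (i, j) * vec n y $ j) = F2"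
    unfolding F2_def by (auto intro!: eq_matI)
  have F12: "dim_row F1 = n" "dim_col F1 = n" "dim_row F2 = n" "dim_col F2 = n"
    unfolding F1_def F2_def by simp_all
  have e_dims: "dim_vec er = n" "dim_vec ec = n" unfolding er_def ec_def by (simp_all add: F12)
  have rt: "round_tm F r c = (P, 9 * (n * n) + 8 * n)"
    unfolding round_tm_def Let_def dims
    by (simp only: tm_simps fst_conv snd_conv dims x_def[symmetric] F1_tm F12 y_def[symmetric] F2_tm
        er_def[symmetric] ec_def[symmetric] P_def[symmetric] e_dims dim_row_sums dim_col_sums) simp
  have P_dim: "P \<in> carrier_mat n n" unfolding P_def by simp
  note R = rounding_correct[of n "\<lambda>i j. F $$ (i, j)" "\<lambda>i. r $ i" "\<lambda>j. c $ j" x "\<lambda>i j. F1 $$ (i, j)" y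
      "\<lambda>i j. F2 $$ (i, j)" "\<lambda>i. er $ i" "\<lambda>j. ec $ j" "\<lambda>i j. P $$ (i, j)"]
  have l1: "l1_norm er = (\<Sum>i<n. \<bar>er $ i\<bar>)" by (simp add: l1_norm_def e_dims)
  have hyps: "\<And>i. i < n \<Longrightarrow> 0 \<le> r $ i" "\<And>j. j < n \<Longrightarrow> 0 \<le> c $ j" "(\<Sum>i<n. r $ i) = (\<Sum>j<n. c $ j)"
    "\<And>i. i < n \<Longrightarrow> x i = min (r $ i / (\<Sum>j<n. F $$ (i, j))) 1"
    "\<And>i j. i < n \<Longrightarrow> j < n \<Longrightarrow> F1 $$ (i, j) = x i * F $$ (i, j)"
    "\<And>j. j < n \<Longrightarrow> y j = min (c $ j / (\<Sum>i<n. F1 $$ (i, j))) 1"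
    "\<And>i j. i < n \<Longrightarrow> j < n \<Longrightarrow> F2 $$ (i, j) = F1 $$ (i, j) * y j"
    "\<And>i. i < n \<Longrightarrow> er $ i = r $ i - (\<Sum>j<n. F2 $$ (i, j))"
    "\<And>j. j < n \<Longrightarrow> ec $ j = c $ j - (\<Sum>i<n. F2 $$ (i, j))"
    "\<And>i j. i < n \<Longrightarrow> j < n \<Longrightarrow> P $$ (i, j) = F2 $$ (i, j) + er $ i * ec $ j / (\<Sum>i<n. \<bar>er $ i\<bar>)"
    subgoal using r by (simp add: pos_prob_vec_def less_imp_le)
    subgoal using c by (simp add: pos_prob_vec_def less_imp_le)
    subgoal using r c by (simp add: pos_prob_vec_def)
    subgoal by (simp add: x_def dims)
    subgoal by (simp add: F1_def)
    subgoal by (simp add: y_def F12)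
    subgoal by (simp add: F2_def)
    subgoal by (simp add: er_def F12)
    subgoal by (simp add: ec_def F12)
    subgoal by (simp add: P_def l1)
    done
  note R = R[OF F(2) hyps]
  have "P \<in> transport_polytope n r c"
    unfolding transport_polytope_iff[OF rc] using P_dim R(1,2,3) by blast
  moreover have "(\<Sum>i<n. \<Sum>j<n. (P $$ (i, j) - F $$ (i, j)) * C i j) \<le> L * marginal_error F r c / 2"
    unfolding marginal_error_eq[OF F(1) rc] by (intro R(4)) (use L in auto)
  ultimately show ?thesis using rt by blast
qed

lemma nonneg_mat_max_norm:
  assumes "nonneg_mat n C" "i < n" "j < n"
  shows "0 \<le> C $$ (i, j)" "C $$ (i, j) \<le> max_norm C"
  using assms entry_le_max_norm[of i C j] by (auto simp: nonneg_mat_def)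

text \<open>The costs are compared along P, B, G, Q, where G is Q rounded to the marginals of B. The
  outer links are rounding errors, the middle one is entropic near-optimality.\<close>

lemma frob_approx:
  assumes n: "2 \<le> n" and C: "nonneg_mat n C" and r: "pos_prob_vec n r" and c: "pos_prob_vec n c"
    and \<epsilon>: "0 < \<epsilon>" and B: "B = diag_scale u (gibbs_kernel C \<epsilon>) v"
    and u: "\<forall>i<n. 0 < u i" and v: "\<forall>j<n. 0 < v j"
    and err: "ereal (marginal_error B r c) \<le> tolerance C \<epsilon>"
    and P: "P \<in> transport_polytope n r c"
    and P_err: "(\<Sum>i<n. \<Sum>j<n. (P $$ (i, j) - B $$ (i, j)) * C $$ (i, j))
      \<le> max_norm C * marginal_error B r c / 2"
    and Q: "Q \<in> transport_polytope n r c"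
  shows "frob P C \<le> frob Q C + \<epsilon>"
proof -
  define L where "L = max_norm C"
  define E where "E = marginal_error B r c"
  have Cn: "dim_row C = n" "dim_col C = n" using C by (auto simp: nonneg_mat_def)
  have C_le: "0 \<le> C $$ (i, j) \<and> C $$ (i, j) \<le> L" if "i < n" "j < n" for i j
    using nonneg_mat_max_norm[OF C that] unfolding L_def by simp
  have L: "0 \<le> L" using C_le[of 0 0] n by linarith
  have rc: "r \<in> carrier_vec n" "c \<in> carrier_vec n" using r c by (auto simp: pos_prob_vec_def)
  note poly = transport_polytope_iff[OF rc]
  have frob: "frob M C = (\<Sum>i<n. \<Sum>j<n. M $$ (i, j) * C $$ (i, j))" if "M \<in> carrier_mat n n" for M
    using that by (simp add: frob_def)
  have P': "P \<in> carrier_mat n n" "\<And>i j. i < n \<Longrightarrow> j < n \<Longrightarrow> 0 \<le> P $$ (i, j)"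
    "\<And>i. i < n \<Longrightarrow> (\<Sum>j<n. P $$ (i, j)) = r $ i" using P unfolding poly by auto
  have Q': "Q \<in> carrier_mat n n" "\<And>i j. i < n \<Longrightarrow> j < n \<Longrightarrow> 0 \<le> Q $$ (i, j)"
    "\<And>i. i < n \<Longrightarrow> (\<Sum>j<n. Q $$ (i, j)) = r $ i" "\<And>j. j < n \<Longrightarrow> (\<Sum>i<n. Q $$ (i, j)) = c $ j"
    using Q unfolding poly by auto
  show ?thesis
  \<comment> \<open>A feasible plan has mass one and costs at most L, so L \<le> \<epsilon> is
    immediate. This disposes of C = 0, where the accuracy is infinite and nothing is known about the
    mass of B.\<close>
  proof (cases "L \<le> \<epsilon>")
    case True
    have "frob P C \<le> (\<Sum>i<n. \<Sum>j<n. P $$ (i, j) * L)"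
      unfolding frob[OF P'(1)] using P'(2) C_le by (intro sum_mono mult_left_mono) auto
    also have "\<dots> = L"
      using P'(3) r by (simp add: pos_prob_vec_def flip: sum_distrib_right)
    finally have "frob P C \<le> \<epsilon>" using True by simp
    moreover have "0 \<le> frob Q C"
      unfolding frob[OF Q'(1)] using Q'(2) C_le by (intro sum_nonneg) auto
    ultimately show ?thesis by simp
  next
    case False
    then have L\<epsilon>: "\<epsilon> < L" "0 < L" using \<epsilon> by auto
    then have E: "E \<le> \<epsilon> / (8 * L)"
      using err unfolding tolerance_def L_def[symmetric] E_def by simp
    have Bn: "B \<in> carrier_mat n n" unfolding B by (simp add: diag_scale_eq gibbs_kernel_def Cn)
    define \<eta> where "\<eta> = eta n \<epsilon>"
    have \<eta>: "0 < \<eta>" using n \<epsilon> unfolding \<eta>_def eta_def by simp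
    have Bi: "B $$ (i, j) = u i * exp (- \<eta> * C $$ (i, j)) * v j" if "i < n" "j < n" for i j
      using that unfolding B \<eta>_def by (simp add: diag_scale_eq gibbs_kernel_def Cn)
    have B_pos: "0 < B $$ (i, j)" if "i < n" "j < n" for i j
      using Bi that u v by simp
    define m where "m = (\<Sum>i<n. \<Sum>j<n. B $$ (i, j))"
    have E_eq: "E = (\<Sum>i<n. \<bar>(\<Sum>j<n. B $$ (i, j)) - r $ i\<bar>) + (\<Sum>j<n. \<bar>(\<Sum>i<n. B $$ (i, j)) - c $ j\<bar>)"
      unfolding E_def by (rule marginal_error_eq[OF Bn rc])
    \<comment> \<open>The excess mass is at most the row error, which is below \<epsilon> / (8 L) <
      1 / 8.\<close>
    have m: "m \<le> 9 / 8"
    proof -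
      have "m - 1 = (\<Sum>i<n. (\<Sum>j<n. B $$ (i, j)) - r $ i)"
        using r by (simp add: m_def sum_subtractf pos_prob_vec_def)
      also have "\<dots> \<le> (\<Sum>i<n. \<bar>(\<Sum>j<n. B $$ (i, j)) - r $ i\<bar>)" by (intro sum_mono) auto
      also have "\<dots> \<le> E" unfolding E_eq by (simp add: sum_nonneg)
      also have "\<dots> \<le> \<epsilon> / (8 * L)" by (rule E)
      also have "\<dots> \<le> 1 / 8" using L\<epsilon> by (simp add: field_simps)
      finally show ?thesis by simp
    qed
    obtain G where G: "\<And>i j. i < n \<Longrightarrow> j < n \<Longrightarrow> 0 \<le> G i j"
      "\<And>i. i < n \<Longrightarrow> (\<Sum>j<n. G i j) = (\<Sum>j<n. B $$ (i, j))"
      "\<And>j. j < n \<Longrightarrow> (\<Sum>i<n. G i j) = (\<Sum>i<n. B $$ (i, j))"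
      and G_err: "\<And>C L. 0 \<le> L \<Longrightarrow> (\<And>i j. i < n \<Longrightarrow> j < n \<Longrightarrow> 0 \<le> C i j \<and> C i j \<le> L) \<Longrightarrow>
        (\<Sum>i<n. \<Sum>j<n. (G i j - Q $$ (i, j)) * C i j) \<le>
        L * ((\<Sum>i<n. \<bar>(\<Sum>j<n. Q $$ (i, j)) - (\<Sum>j<n. B $$ (i, j))\<bar>)
          + (\<Sum>j<n. \<bar>(\<Sum>i<n. Q $$ (i, j)) - (\<Sum>i<n. B $$ (i, j))\<bar>)) / 2"
    proof (rule rounding_exists[of n "\<lambda>i j. Q $$ (i, j)" "\<lambda>i. \<Sum>j<n. B $$ (i, j)" "\<lambda>j. \<Sum>i<n. B $$ (i, j)"])
      show "(\<Sum>i<n. \<Sum>j<n. B $$ (i, j)) = (\<Sum>j<n. \<Sum>i<n. B $$ (i, j))" by (rule sum.swap)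
    qed (use Q' less_imp_le[OF B_pos] in \<open>auto intro!: sum_nonneg\<close>)
    have LE: "L * E / 2 \<le> \<epsilon> / 16" using E L\<epsilon> by (simp add: field_simps)
    have 1: "frob P C - frob B C \<le> \<epsilon> / 16"
      using order_trans[OF P_err[folded L_def E_def] LE] unfolding frob[OF P'(1)] frob[OF Bn]
      by (simp add: left_diff_distrib sum_subtractf)
    have "(\<Sum>i<n. \<Sum>j<n. (G i j - Q $$ (i, j)) * C $$ (i, j)) \<le> L * E / 2"
      using G_err[of L "\<lambda>i j. C $$ (i, j)", OF L C_le] Q'(3,4) unfolding E_eq
      by (simp add: abs_minus_commute)
    from order_trans[OF this LE]
    have 2: "(\<Sum>i<n. \<Sum>j<n. G i j * C $$ (i, j)) - frob Q C \<le> \<epsilon> / 16"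
      unfolding frob[OF Q'(1)] by (simp add: left_diff_distrib sum_subtractf)
    have "\<eta> * (\<Sum>i<n. \<Sum>j<n. (B $$ (i, j) - G i j) * C $$ (i, j)) \<le> 2 * ln n * m"
      unfolding m_def
      by (rule gibbs_scaling_near_optimal[where u = u and v = v]) (use n Bi u v G in auto)
    \<comment> \<open>The factor 4 in \<open>eta\<close> turns the entropy term 2 m ln n / \<eta>
      into m \<epsilon> / 2.\<close>
    moreover have "\<eta> * (m * \<epsilon> / 2) = 2 * ln n * m"
      using \<epsilon> by (simp add: \<eta>_def eta_def)
    ultimately have "\<eta> * (\<Sum>i<n. \<Sum>j<n. (B $$ (i, j) - G i j) * C $$ (i, j)) \<le> \<eta> * (m * \<epsilon> / 2)"
      by (simp only:)
    then have "(\<Sum>i<n. \<Sum>j<n. (B $$ (i, j) - G i j) * C $$ (i, j)) \<le> m * \<epsilon> / 2"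
      using \<eta> by simp
    then have 3: "frob B C - (\<Sum>i<n. \<Sum>j<n. G i j * C $$ (i, j)) \<le> m * \<epsilon> / 2"
      unfolding frob[OF Bn] by (simp add: left_diff_distrib sum_subtractf)
    \<comment> \<open>The three links sum to at most (1 + 9 + 1) / 16 of \<epsilon>.\<close>
    have "m * \<epsilon> \<le> 9 / 8 * \<epsilon>" using m \<epsilon> by (intro mult_right_mono) auto
    then show ?thesis using 1 2 3 \<epsilon> by linarith
  qed
qed

section \<open>The set-up phase, the accuracy, and the guarantee for an arbitrary projection\<close>

lemma max_norm_nested:
  assumes "C \<in> carrier_mat n n" "0 < n"
  shows "max_norm C = Max ((\<lambda>i. Max ((\<lambda>j. \<bar>C $$ (i, j)\<bar>) ` {..<n})) ` {..<n})"
proof -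
  let ?row = "\<lambda>i. Max ((\<lambda>j. \<bar>C $$ (i, j)\<bar>) ` {..<n})"
  have ne: "{..<n} \<noteq> {}" using assms by auto
  show ?thesis
    unfolding max_norm_def
  proof (rule Max_eqI)
    show "finite (abs ` elements_mat C)" by (simp add: elements_mat_def)
  next
    fix z assume "z \<in> abs ` elements_mat C"
    then obtain i j where "i < n" "j < n" and z: "z = \<bar>C $$ (i, j)\<bar>" using assms by auto
    then have "z \<le> ?row i" by (intro Max_ge) auto
    also have "\<dots> \<le> Max (?row ` {..<n})" using \<open>i < n\<close> by (intro Max_ge) auto
    finally show "z \<le> Max (?row ` {..<n})" .
  next
    have "Max (?row ` {..<n}) \<in> ?row ` {..<n}" using ne by (intro Max_in) auto
    then obtain i where i: "i < n" "Max (?row ` {..<n}) = ?row i" by auto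
    have "?row i \<in> (\<lambda>j. \<bar>C $$ (i, j)\<bar>) ` {..<n}" using ne by (intro Max_in) auto
    then show "Max (?row ` {..<n}) \<in> abs ` elements_mat C"
      using i assms elements_matI[OF assms(1)] by auto
  qed
qed

lemma setup_tm_eq:
  assumes "C \<in> carrier_mat n n" "0 < n"
  shows "setup_tm C \<epsilon> = ((gibbs_kernel C \<epsilon>, tolerance C \<epsilon>), 4 * (n * n) + n + 6)"
proof -
  have dims: "dim_row C = n" "dim_col C = n" using assms by auto
  have "mat n n (\<lambda>(i, j). exp (- (4 * ln (real n) / \<epsilon>) * C $$ (i, j))) = gibbs_kernel C \<epsilon>"
    by (auto simp: gibbs_kernel_def eta_def dims intro!: eq_matI)
  then show ?thesis
    using max_norm_nested[OF assms]
    by (simp add: setup_tm_def Let_def dims bind_tm_def op_def ret_def max_tm_def mat_tm_def tolerance_def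
      distrib_left)
qed

lemma gibbs_kernel_pos: "nonneg_mat n C \<Longrightarrow> pos_mat n (gibbs_kernel C \<epsilon>)"
  by (auto simp: nonneg_mat_def pos_mat_def gibbs_kernel_def)

lemma le_tolerance:
  assumes C: "nonneg_mat n C" and n: "0 < n" and L: "max_norm C \<le> L" "0 < L" and \<epsilon>: "0 < \<epsilon>"
  shows "ereal (\<epsilon> / (8 * L)) \<le> tolerance C \<epsilon>"
proof (cases "max_norm C = 0")
  \<comment> \<open>For C = 0 a positive number is divided by 0 in the extended reals, and the
    accuracy is infinite.\<close>
  case True
  then show ?thesis using \<epsilon> by (simp add: tolerance_def)
next
  case False
  then have "0 < max_norm C" using nonneg_mat_max_norm[OF C n n] by linarith
  then show ?thesis using L \<epsilon> by (simp add: tolerance_def frac_le)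
qed

lemma tolerance_pos:
  assumes "nonneg_mat n C" "0 < n" "0 < \<epsilon>"
  shows "0 < tolerance C \<epsilon>"
proof -
  have "0 \<le> max_norm C" using nonneg_mat_max_norm[OF assms(1,2,2)] by linarith
  \<comment> \<open>Adding 1 keeps the denominator positive even for C = 0.\<close>
  then have "ereal (\<epsilon> / (8 * (max_norm C + 1))) \<le> tolerance C \<epsilon>"
    using assms by (intro le_tolerance) auto
  moreover have "0 < ereal (\<epsilon> / (8 * (max_norm C + 1)))"
    using \<open>0 \<le> max_norm C\<close> assms by simp
  ultimately show ?thesis by (rule less_le_trans[rotated])
qed

lemma approx_ot_correct:
  assumes n: "2 \<le> n" and C: "nonneg_mat n C" and r: "pos_prob_vec n r" and c: "pos_prob_vec n c"
    and \<epsilon>: "0 < \<epsilon>" and proj: "proj_subroutine n proj"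
  shows "\<exists>P T B S. proj (gibbs_kernel C \<epsilon>) r c (tolerance C \<epsilon>) = Some (B, S) \<and>
    approx_ot proj C r c \<epsilon> = Some (P, T) \<and> P \<in> transport_polytope n r c \<and>
    (\<forall>Q \<in> transport_polytope n r c. frob P C \<le> frob Q C + \<epsilon>) \<and>
    real T \<le> 100 * (real n ^ 2 + real S)"
proof -
  have Cn: "C \<in> carrier_mat n n" and n0: "0 < n" using C n by (auto simp: nonneg_mat_def)
  obtain B S u v where pr: "proj (gibbs_kernel C \<epsilon>) r c (tolerance C \<epsilon>) = Some (B, S)"
    and u: "\<forall>i<n. 0 < u i" and v: "\<forall>j<n. 0 < v j" and B: "B = diag_scale u (gibbs_kernel C \<epsilon>) v"
    and err: "ereal (marginal_error B r c) \<le> tolerance C \<epsilon>"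
    using proj gibbs_kernel_pos[OF C] r c tolerance_pos[OF C n0 \<epsilon>] unfolding proj_subroutine_def by metis
  have Bn: "B \<in> carrier_mat n n" using Cn by (auto simp: B diag_scale_eq gibbs_kernel_def)
  have B_nonneg: "0 \<le> B $$ (i, j)" if "i < n" "j < n" for i j
    using that u v Cn by (auto simp: B diag_scale_eq gibbs_kernel_def less_imp_le)
  have L: "0 \<le> max_norm C" using nonneg_mat_max_norm[OF C n0 n0] by linarith
  have C_le: "0 \<le> C $$ (i, j) \<and> C $$ (i, j) \<le> max_norm C" if "i < n" "j < n" for i j
    using nonneg_mat_max_norm[OF C that] by simp
  obtain P where rnd: "round_tm B r c = (P, 9 * (n * n) + 8 * n)" and P: "P \<in> transport_polytope n r c"
    and P_err: "(\<Sum>i<n. \<Sum>j<n. (P $$ (i, j) - B $$ (i, j)) * C $$ (i, j))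
      \<le> max_norm C * marginal_error B r c / 2"
    using round_tm_correct[where C = "\<lambda>i j. C $$ (i, j)", OF Bn B_nonneg r c L C_le] by blast
  show ?thesis
  proof (intro exI conjI ballI)
    show "proj (gibbs_kernel C \<epsilon>) r c (tolerance C \<epsilon>) = Some (B, S)" by (rule pr)
    show "approx_ot proj C r c \<epsilon> = Some (P, 4 * (n * n) + n + 6 + S + (9 * (n * n) + 8 * n))"
      using pr rnd by (simp add: approx_ot_def setup_tm_eq[OF Cn n0])
    show "P \<in> transport_polytope n r c" by (rule P)
    have "real (4 * (n * n) + n + 6 + S + (9 * (n * n) + 8 * n)) = 13 * real n ^ 2 + 9 * real n + 6 + real S"
      by (simp add: power2_eq_square)
    moreover have "2 * real n \<le> real n ^ 2" "2 \<le> real n" "0 \<le> real S"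
      using n by (auto simp: power2_eq_square)
    ultimately show "real (4 * (n * n) + n + 6 + S + (9 * (n * n) + 8 * n)) \<le> 100 * (real n ^ 2 + real S)"
      by argo
    show "frob P C \<le> frob Q C + \<epsilon>" if "Q \<in> transport_polytope n r c" for Q
      by (rule frob_approx[OF n C r c \<epsilon> B u v err P P_err that])
  qed
qed

section \<open>The scaling algorithms as projection subroutines\<close>

text \<open>Termination on arbitrary positive inputs needs only some \<open>d\<close> and
  \<open>l\<close>, with no control on their size: the accuracy truncated at 1, and the least
  normalised entry.\<close>

lemma scaling_problem_exists:
  assumes "pos_mat n A" "pos_prob_vec n r" "pos_prob_vec n c" "0 < \<delta>"
  shows "\<exists>d l. scaling_problem n A r c \<delta> d \<and> 0 < l \<and>
    (\<forall>i j. i < n \<longrightarrow> j < n \<longrightarrow> l \<le> scaling_problem.A0 A $$ (i, j))"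
proof -
  obtain d where d: "0 < d" "d \<le> 1" "ereal d \<le> \<delta>"
  proof (cases \<delta>)
    case (real x)
    then show thesis using assms(4) by (intro that[of "min 1 x"]) auto
  next
    case PInf
    then show thesis by (intro that[of 1]) auto
  qed (use assms(4) in auto)
  interpret scaling_problem n A r c \<delta> d
    using assms d by unfold_locales
  let ?S = "(\<lambda>(i, j). A0 $$ (i, j)) ` ({..<n} \<times> {..<n})"
  have S: "finite ?S" "?S \<noteq> {}" using n_pos by auto
  have "0 < Min ?S" using S A0_pos by (subst Min_gr_iff) auto
  moreover have "Min ?S \<le> A0 $$ (i, j)" if "i < n" "j < n" for i j
    using S that by (intro Min_le) auto
  ultimately show ?thesis using scaling_problem_axioms by blast
qed

lemma proj_subroutine_sinkhorn: "proj_subroutine n sinkhorn"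
  unfolding proj_subroutine_def
proof (intro allI impI, elim conjE)
  fix A r c and \<delta> :: ereal
  assume "pos_mat n A" "pos_prob_vec n r" "pos_prob_vec n c" "0 < \<delta>"
  from scaling_problem_exists[OF this] obtain d l where "scaling_problem n A r c \<delta> d"
    and l: "0 < l" "\<And>i j. i < n \<Longrightarrow> j < n \<Longrightarrow> l \<le> scaling_problem.A0 A $$ (i, j)"
    by blast
  then interpret scaling_problem n A r c \<delta> d by simp
  show "\<exists>B S. sinkhorn A r c \<delta> = Some (B, S) \<and>
      (\<exists>x y. (\<forall>i<n. 0 < x i) \<and> (\<forall>j<n. 0 < y j) \<and> B = diag_scale x A y) \<and>
      ereal (marginal_error B r c) \<le> \<delta>"
    using sinkhorn_terminates[OF l] exp_scale_diag_scale by blast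
qed

lemma proj_subroutine_greenkhorn:
  assumes sel: "argmax_selector selr" "argmax_selector selc"
  shows "proj_subroutine n (greenkhorn selr selc)"
  unfolding proj_subroutine_def
proof (intro allI impI, elim conjE)
  fix A r c and \<delta> :: ereal
  assume "pos_mat n A" "pos_prob_vec n r" "pos_prob_vec n c" "0 < \<delta>"
  from scaling_problem_exists[OF this] obtain d l where "scaling_problem n A r c \<delta> d"
    and l: "0 < l" "\<And>i j. i < n \<Longrightarrow> j < n \<Longrightarrow> l \<le> scaling_problem.A0 A $$ (i, j)"
    by blast
  then interpret scaling_problem n A r c \<delta> d by simp
  show "\<exists>B S. greenkhorn selr selc A r c \<delta> = Some (B, S) \<and>
      (\<exists>x y. (\<forall>i<n. 0 < x i) \<and> (\<forall>j<n. 0 < y j) \<and> B = diag_scale x A y) \<and>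
      ereal (marginal_error B r c) \<le> \<delta>"
    using greenkhorn_terminates[OF sel l] exp_scale_diag_scale by blast
qed

lemma greenkhorn_eq_spec:
  assumes "argmax_selector selr" "argmax_selector selc"
    and "pos_mat n A" "pos_prob_vec n r" "pos_prob_vec n c" "0 < \<delta>"
  shows "map_option fst (greenkhorn selr selc A r c \<delta>) = greenkhorn_spec selr selc A r c \<delta>"
proof -
  obtain d where "scaling_problem n A r c \<delta> d"
    using scaling_problem_exists[OF assms(3-6)] by blast
  then show ?thesis using scaling_problem.greenkhorn_refines_spec assms by blast
qed

text \<open>Since 0 \<le> C \<le> L, kernel entries lie between exp (- \<eta> L) and 1, so their
  total is at most n^2.\<close>

lemma gibbs_kernel_normalized_ge:
  assumes C: "nonneg_mat n C" and n: "2 \<le> n" and \<epsilon>: "0 < \<epsilon>" and L: "max_norm C \<le> L"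
    and ij: "i < n" "j < n"
  shows "exp (- eta n \<epsilon> * L) / real n ^ 2
    \<le> gibbs_kernel C \<epsilon> $$ (i, j) / entry_l1_norm (gibbs_kernel C \<epsilon>)"
proof -
  let ?A = "gibbs_kernel C \<epsilon>"
  have \<eta>: "0 \<le> eta n \<epsilon>" using n \<epsilon> by (simp add: eta_def)
  have Cn: "dim_row C = n" "dim_col C = n" using C by (auto simp: nonneg_mat_def)
  have A: "?A $$ (i, j) = exp (- eta n \<epsilon> * C $$ (i, j))" if "i < n" "j < n" for i j
    using that Cn by (simp add: gibbs_kernel_def)
  have A_le: "?A $$ (i, j) \<le> 1" if "i < n" "j < n" for i j
    using A[OF that] \<eta> nonneg_mat_max_norm[OF C that] by simp
  have A_pos: "0 < ?A $$ (i, j)" if "i < n" "j < n" for i j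
    using A[OF that] by simp
  have A_dim: "dim_row ?A = n" "dim_col ?A = n" by (simp_all add: gibbs_kernel_def Cn)
  have norm: "entry_l1_norm ?A = (\<Sum>i<n. \<Sum>j<n. ?A $$ (i, j))"
    using A_pos by (auto simp: entry_l1_norm_def A_dim less_imp_le intro!: sum.cong)
  have "entry_l1_norm ?A \<le> (\<Sum>i<n. \<Sum>j<n. 1)"
    unfolding norm using A_le by (intro sum_mono) auto
  then have norm_le: "entry_l1_norm ?A \<le> real n ^ 2" by (simp add: power2_eq_square)
  have norm_pos: "0 < entry_l1_norm ?A"
    unfolding norm using A_pos ij by (intro sum_pos) auto
  have "C $$ (i, j) \<le> L" using nonneg_mat_max_norm[OF C ij] L by linarith
  then have "exp (- eta n \<epsilon> * L) \<le> ?A $$ (i, j)"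
    unfolding A[OF ij] using \<eta> by (simp add: mult_left_mono)
  then show ?thesis
    using norm_le norm_pos A_pos[OF ij] by (intro frac_le) auto
qed

text \<open>With \<open>z = L / \<epsilon>\<close>: the logarithm of the smallest normalized entry is of order
  \<open>z ln n\<close>, and the inverse square of the accuracy is of order \<open>z\<^sup>2\<close>.\<close>

lemma scaling_cost_bound:
  assumes n: "2 \<le> n" and \<epsilon>: "0 < \<epsilon>" and L: "0 < L" and \<kappa>: "0 < \<kappa>" "\<epsilon> \<le> \<kappa> * L"
  defines "X \<equiv> real n ^ 2 * L ^ 3 * ln (real n) / \<epsilon> ^ 3"
    and "M \<equiv> \<kappa> ^ 3 / ln 2 + (4 + 2 * \<kappa>) * (\<kappa>\<^sup>2 + 64)"
  shows "real n ^ 2 \<le> M * X"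
    and "real n ^ 2 * (1 + - ln (exp (- eta n \<epsilon> * L) / real n ^ 2) / (min 1 (\<epsilon> / (8 * L)))\<^sup>2) \<le> M * X"
proof -
  define z where "z = L / \<epsilon>"
  have z: "0 < z" "1 \<le> \<kappa> * z" using L \<epsilon> \<kappa> by (auto simp: z_def field_simps)
  have ln_n: "ln 2 \<le> ln (real n)" "0 < ln (real n)" using n by auto
  have X: "X = real n ^ 2 * (z ^ 3 * ln (real n))"
    by (simp add: X_def z_def power_divide)
  \<comment> \<open>The additive 1 in the cost is charged to the main term through \<kappa> z \<ge>
    1 and ln n \<ge> ln 2; this is the first summand of M.\<close>
  have "1 * 1 \<le> (\<kappa> * z) ^ 3 * (ln (real n) / ln 2)"
    using z ln_n by (intro mult_mono one_le_power) auto
  then have one: "1 \<le> \<kappa> ^ 3 / ln 2 * (z ^ 3 * ln (real n))"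
    by (simp add: power_mult_distrib)
  let ?l = "- ln (exp (- eta n \<epsilon> * L) / real n ^ 2)" and ?d = "min 1 (\<epsilon> / (8 * L))"
  have l: "?l = ln (real n) * (4 * z + 2)"
    using n by (simp add: ln_div ln_realpow eta_def z_def algebra_simps)
  have "4 * z + 2 \<le> (4 + 2 * \<kappa>) * z" using z by (simp add: algebra_simps)
  then have l_le: "?l \<le> ln (real n) * ((4 + 2 * \<kappa>) * z)"
    unfolding l using ln_n by (intro mult_left_mono) auto
  have l0: "0 \<le> ?l" unfolding l using ln_n z by simp
  \<comment> \<open>The two regimes of the minimum give \<kappa>^2 and 64 = 8^2; their sum covers
    both.\<close>
  have d: "1 / ?d\<^sup>2 \<le> (\<kappa>\<^sup>2 + 64) * z\<^sup>2"
  proof (cases "1 \<le> \<epsilon> / (8 * L)")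
    case True
    have "1 * 1 \<le> (\<kappa> * z) * (\<kappa> * z)" using z by (intro mult_mono) auto
    then have "1 \<le> \<kappa>\<^sup>2 * z\<^sup>2" by (simp add: power2_eq_square algebra_simps)
    then have "1 \<le> (\<kappa>\<^sup>2 + 64) * z\<^sup>2" by (simp add: distrib_right add_increasing2)
    then show ?thesis using True by (simp add: min_def)
  next
    case False
    then have "?d = \<epsilon> / (8 * L)" by simp
    then have "1 / ?d\<^sup>2 = 64 * z\<^sup>2"
      by (simp add: z_def power_divide power_mult_distrib)
    then show ?thesis by (simp add: distrib_right)
  qed
  have "?l / ?d\<^sup>2 = ?l * (1 / ?d\<^sup>2)" by simp
  also have "\<dots> \<le> (ln (real n) * ((4 + 2 * \<kappa>) * z)) * ((\<kappa>\<^sup>2 + 64) * z\<^sup>2)"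
    using l_le d l0 ln_n z \<kappa> by (intro mult_mono) auto
  also have "\<dots> = (4 + 2 * \<kappa>) * (\<kappa>\<^sup>2 + 64) * (z ^ 3 * ln (real n))"
    by (simp add: power2_eq_square power3_eq_cube)
  finally have frac: "?l / ?d\<^sup>2 \<le> (4 + 2 * \<kappa>) * (\<kappa>\<^sup>2 + 64) * (z ^ 3 * ln (real n))" .
  have sum: "1 + ?l / ?d\<^sup>2 \<le> M * (z ^ 3 * ln (real n))"
    unfolding M_def distrib_right[of "\<kappa> ^ 3 / ln 2"] by (rule add_mono[OF one frac])
  have MX: "M * X = real n ^ 2 * (M * (z ^ 3 * ln (real n)))" unfolding X by simp
  show *: "real n ^ 2 * (1 + ?l / ?d\<^sup>2) \<le> M * X"
    unfolding MX using sum by (intro mult_left_mono) auto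
  have "real n ^ 2 * 1 \<le> real n ^ 2 * (1 + ?l / ?d\<^sup>2)"
    using divide_nonneg_nonneg[OF l0 zero_le_power2] by (intro mult_left_mono) auto
  then show "real n ^ 2 \<le> M * X" using * by linarith
qed

text \<open>Both the accuracy and the least entry are expressed through \<open>L\<close> instead of
  the norm of \<open>C\<close>, which is legitimate because a larger \<open>L\<close> only lowers
  both.\<close>

lemma scaling_subroutine_cost:
  assumes n: "2 \<le> n" and C: "nonneg_mat n C" and r: "pos_prob_vec n r" and c: "pos_prob_vec n c"
    and \<epsilon>: "0 < \<epsilon>" and L: "max_norm C \<le> L" "0 < L" and \<kappa>: "0 < \<kappa>" "\<epsilon> \<le> \<kappa> * L"
    and sel: "argmax_selector selr" "argmax_selector selc"
    and proj: "proj \<in> {sinkhorn, greenkhorn selr selc}"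
    and res: "proj (gibbs_kernel C \<epsilon>) r c (tolerance C \<epsilon>) = Some (B, S)"
  shows "real S \<le> 700 * ((\<kappa> ^ 3 / ln 2 + (4 + 2 * \<kappa>) * (\<kappa>\<^sup>2 + 64)) *
    (real n ^ 2 * L ^ 3 * ln (real n) / \<epsilon> ^ 3))"
proof -
  define d where "d = min 1 (\<epsilon> / (8 * L))"
  define l where "l = exp (- eta n \<epsilon> * L) / real n ^ 2"
  have d: "0 < d" "d \<le> 1" using \<epsilon> L by (auto simp: d_def)
  have "ereal d \<le> ereal (\<epsilon> / (8 * L))" by (simp add: d_def)
  also have "\<dots> \<le> tolerance C \<epsilon>" using n by (intro le_tolerance[OF C _ L \<epsilon>]) simp
  finally interpret scaling_problem n "gibbs_kernel C \<epsilon>" r c "tolerance C \<epsilon>" d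
    using gibbs_kernel_pos[OF C] r c d by unfold_locales
  have l: "0 < l" "\<And>i j. i < n \<Longrightarrow> j < n \<Longrightarrow> l \<le> A0 $$ (i, j)"
    using n gibbs_kernel_normalized_ge[OF C n \<epsilon> L(1)] by (auto simp: l_def A0_def)
  have "real S \<le> 700 * real n ^ 2 * (1 + - ln l / d\<^sup>2)"
    using proj res sinkhorn_terminates[OF l] greenkhorn_terminates[OF sel l] by auto
  also have "\<dots> = 700 * (real n ^ 2 * (1 + - ln l / d\<^sup>2))" by simp
  finally show ?thesis
    using scaling_cost_bound(2)[OF n \<epsilon> L(2) \<kappa>] unfolding d_def l_def by linarith
qed

section \<open>Assembly of accuracy, correctness of the two projections, and running time\<close>

theorem theorem1:
  shows
    "(\<exists>K>0. \<forall>(n::nat) (C::real mat) (r::real vec) (c::real vec) (\<epsilon>::real) (proj::subroutine).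
        2 \<le> n \<and> nonneg_mat n C \<and> pos_prob_vec n r \<and> pos_prob_vec n c \<and> 0 < \<epsilon> \<and>
        proj_subroutine n proj \<longrightarrow>
        (\<exists>P T B S.
           proj (gibbs_kernel C \<epsilon>) r c (tolerance C \<epsilon>) = Some (B, S) \<and>
           approx_ot proj C r c \<epsilon> = Some (P, T) \<and>
           P \<in> transport_polytope n r c \<and>
           (\<exists>Q. is_arg_min (\<lambda>R. frob R C) (\<lambda>R. R \<in> transport_polytope n r c) Q \<and>
                frob P C \<le> frob Q C + \<epsilon>) \<and>
           real T \<le> K * (real n ^ 2 + real S))) \<and>
     (\<forall>(n::nat) selr selc. argmax_selector selr \<and> argmax_selector selc \<longrightarrow>
        proj_subroutine n sinkhorn \<and>
        proj_subroutine n (greenkhorn selr selc) \<and>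
        (\<forall>A r c \<delta>. pos_mat n A \<and> pos_prob_vec n r \<and> pos_prob_vec n c \<and> 0 < \<delta> \<longrightarrow>
           map_option fst (greenkhorn selr selc A r c \<delta>) = greenkhorn_spec selr selc A r c \<delta>)) \<and>
     (\<forall>\<kappa>>0. \<exists>K>0. \<forall>(n::nat) (C::real mat) (r::real vec) (c::real vec) (\<epsilon>::real) (L::real)
          selr selc proj.
        2 \<le> n \<and> nonneg_mat n C \<and> pos_prob_vec n r \<and> pos_prob_vec n c \<and> 0 < \<epsilon> \<and>
        max_norm C \<le> L \<and> \<epsilon> \<le> \<kappa> * L \<and>
        argmax_selector selr \<and> argmax_selector selc \<and>
        proj \<in> {sinkhorn, greenkhorn selr selc} \<longrightarrow>
        (\<exists>P T B S.
           proj (gibbs_kernel C \<epsilon>) r c (tolerance C \<epsilon>) = Some (B, S) \<and>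
           real S \<le> K * (real n ^ 2 * L ^ 3 * ln (real n) / \<epsilon> ^ 3) \<and>
           approx_ot proj C r c \<epsilon> = Some (P, T) \<and>
           real T \<le> K * (real n ^ 2 * L ^ 3 * ln (real n) / \<epsilon> ^ 3)))"
proof (intro conjI)
  show "\<exists>K>0. \<forall>(n::nat) (C::real mat) (r::real vec) (c::real vec) (\<epsilon>::real) (proj::subroutine).
      2 \<le> n \<and> nonneg_mat n C \<and> pos_prob_vec n r \<and> pos_prob_vec n c \<and> 0 < \<epsilon> \<and>
      proj_subroutine n proj \<longrightarrow>
      (\<exists>P T B S.
         proj (gibbs_kernel C \<epsilon>) r c (tolerance C \<epsilon>) = Some (B, S) \<and>
         approx_ot proj C r c \<epsilon> = Some (P, T) \<and>
         P \<in> transport_polytope n r c \<and>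
         (\<exists>Q. is_arg_min (\<lambda>R. frob R C) (\<lambda>R. R \<in> transport_polytope n r c) Q \<and>
              frob P C \<le> frob Q C + \<epsilon>) \<and>
         real T \<le> K * (real n ^ 2 + real S))"
  proof (intro exI[of _ 100] conjI allI impI; (elim conjE)?)
    fix n C r c \<epsilon> and proj :: subroutine
    assume n: "2 \<le> n" and C: "nonneg_mat n C" and r: "pos_prob_vec n r" and c: "pos_prob_vec n c"
      and \<epsilon>: "(0 :: real) < \<epsilon>" and proj: "proj_subroutine n proj"
    obtain Q where Q: "is_arg_min (\<lambda>R. frob R C) (\<lambda>R. R \<in> transport_polytope n r c) Q"
      using transport_polytope_min_exists[OF r c C] by blast
    then have "Q \<in> transport_polytope n r c" by (simp add: is_arg_min_def)
    moreover obtain P T B S where "proj (gibbs_kernel C \<epsilon>) r c (tolerance C \<epsilon>) = Some (B, S)"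
      "approx_ot proj C r c \<epsilon> = Some (P, T)" "P \<in> transport_polytope n r c"
      "\<forall>Q \<in> transport_polytope n r c. frob P C \<le> frob Q C + \<epsilon>"
      "real T \<le> 100 * (real n ^ 2 + real S)"
      using approx_ot_correct[OF n C r c \<epsilon> proj] by blast
    ultimately show "\<exists>P T B S.
         proj (gibbs_kernel C \<epsilon>) r c (tolerance C \<epsilon>) = Some (B, S) \<and>
         approx_ot proj C r c \<epsilon> = Some (P, T) \<and>
         P \<in> transport_polytope n r c \<and>
         (\<exists>Q. is_arg_min (\<lambda>R. frob R C) (\<lambda>R. R \<in> transport_polytope n r c) Q \<and>
              frob P C \<le> frob Q C + \<epsilon>) \<and>
         real T \<le> 100 * (real n ^ 2 + real S)"
      using Q by blast
  qed simp
  show "\<forall>(n::nat) selr selc. argmax_selector selr \<and> argmax_selector selc \<longrightarrow>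
      proj_subroutine n sinkhorn \<and>
      proj_subroutine n (greenkhorn selr selc) \<and>
      (\<forall>A r c \<delta>. pos_mat n A \<and> pos_prob_vec n r \<and> pos_prob_vec n c \<and> 0 < \<delta> \<longrightarrow>
         map_option fst (greenkhorn selr selc A r c \<delta>) = greenkhorn_spec selr selc A r c \<delta>)"
    using proj_subroutine_sinkhorn proj_subroutine_greenkhorn greenkhorn_eq_spec by blast
  show "\<forall>\<kappa>>0. \<exists>K>0. \<forall>(n::nat) (C::real mat) (r::real vec) (c::real vec) (\<epsilon>::real) (L::real)
        selr selc proj.
      2 \<le> n \<and> nonneg_mat n C \<and> pos_prob_vec n r \<and> pos_prob_vec n c \<and> 0 < \<epsilon> \<and>
      max_norm C \<le> L \<and> \<epsilon> \<le> \<kappa> * L \<and>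
      argmax_selector selr \<and> argmax_selector selc \<and>
      proj \<in> {sinkhorn, greenkhorn selr selc} \<longrightarrow>
      (\<exists>P T B S.
         proj (gibbs_kernel C \<epsilon>) r c (tolerance C \<epsilon>) = Some (B, S) \<and>
         real S \<le> K * (real n ^ 2 * L ^ 3 * ln (real n) / \<epsilon> ^ 3) \<and>
         approx_ot proj C r c \<epsilon> = Some (P, T) \<and>
         real T \<le> K * (real n ^ 2 * L ^ 3 * ln (real n) / \<epsilon> ^ 3))"
  proof (intro allI impI)
    fix \<kappa> :: real assume \<kappa>: "0 < \<kappa>"
    define M where "M = \<kappa> ^ 3 / ln 2 + (4 + 2 * \<kappa>) * (\<kappa>\<^sup>2 + 64)"
    have M: "0 < M" using \<kappa> unfolding M_def by (intro add_pos_pos mult_pos_pos divide_pos_pos) auto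
    show "\<exists>K>0. \<forall>(n::nat) (C::real mat) (r::real vec) (c::real vec) (\<epsilon>::real) (L::real)
        selr selc proj.
      2 \<le> n \<and> nonneg_mat n C \<and> pos_prob_vec n r \<and> pos_prob_vec n c \<and> 0 < \<epsilon> \<and>
      max_norm C \<le> L \<and> \<epsilon> \<le> \<kappa> * L \<and>
      argmax_selector selr \<and> argmax_selector selc \<and>
      proj \<in> {sinkhorn, greenkhorn selr selc} \<longrightarrow>
      (\<exists>P T B S.
         proj (gibbs_kernel C \<epsilon>) r c (tolerance C \<epsilon>) = Some (B, S) \<and>
         real S \<le> K * (real n ^ 2 * L ^ 3 * ln (real n) / \<epsilon> ^ 3) \<and>
         approx_ot proj C r c \<epsilon> = Some (P, T) \<and>
         real T \<le> K * (real n ^ 2 * L ^ 3 * ln (real n) / \<epsilon> ^ 3))"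
    \<comment> \<open>The constant is 100 (1 + 700): both n^2 and S / 700 are at most M times the
      claimed rate.\<close>
    proof (intro exI[of _ "70100 * M"] conjI allI impI; (elim conjE)?)
      fix n C r c and \<epsilon> L :: real and selr selc and proj :: subroutine
      assume n: "2 \<le> n" and C: "nonneg_mat n C" and r: "pos_prob_vec n r" and c: "pos_prob_vec n c"
        and \<epsilon>: "0 < \<epsilon>" and L: "max_norm C \<le> L" and \<kappa>L: "\<epsilon> \<le> \<kappa> * L"
        and sel: "argmax_selector selr" "argmax_selector selc"
        and proj: "proj \<in> {sinkhorn, greenkhorn selr selc}"
      let ?X = "real n ^ 2 * L ^ 3 * ln (real n) / \<epsilon> ^ 3"
      \<comment> \<open>Positivity of \<open>L\<close> is forced by 0 < \<epsilon> \<le> \<kappa>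
        \<open>L\<close>.\<close>
      have L0: "0 < L"
        using \<epsilon> \<kappa> \<kappa>L by (metis less_le_trans zero_less_mult_pos)
      have "proj_subroutine n proj"
        using proj proj_subroutine_sinkhorn proj_subroutine_greenkhorn[OF sel] by auto
      then obtain P T B S where res: "proj (gibbs_kernel C \<epsilon>) r c (tolerance C \<epsilon>) = Some (B, S)"
        and out: "approx_ot proj C r c \<epsilon> = Some (P, T)"
        and T: "real T \<le> 100 * (real n ^ 2 + real S)"
        by (metis approx_ot_correct[OF n C r c \<epsilon>])
      have S: "real S \<le> 700 * (M * ?X)"
        unfolding M_def by (rule scaling_subroutine_cost[OF n C r c \<epsilon> L L0 \<kappa> \<kappa>L sel proj res])
      have n2: "real n ^ 2 \<le> M * ?X"
        unfolding M_def by (rule scaling_cost_bound(1)[OF n \<epsilon> L0 \<kappa> \<kappa>L])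
      have "real S \<le> 70100 * M * ?X" "real T \<le> 70100 * M * ?X"
        using S T n2 zero_le_power2[of "real n"] by argo+
      then show "\<exists>P T B S.
         proj (gibbs_kernel C \<epsilon>) r c (tolerance C \<epsilon>) = Some (B, S) \<and>
         real S \<le> 70100 * M * ?X \<and>
         approx_ot proj C r c \<epsilon> = Some (P, T) \<and>
         real T \<le> 70100 * M * ?X"
        using res out by blast
    qed (use M in simp)
  qed
qed

end
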